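(* Let $\mathcal{F}$ be a saturated fusion system over a finite $p$-group $S$. Then the local rank satisfies $\mathrm{rank}_l(\mathcal{F})=1$ if and only if $\mathcal{F}^e=\{O_p(\mathcal{F})\}$, where $\mathcal{F}^e$ is the set of $\mathcal{F}$-essential subgroups of $S$.
   Context: For a saturated fusion system $\mathcal{F}$ over a finite $p$-group $S$ and $Q\le S$: $Q$ is fully $\mathcal{F}$-normalised if $|N_S(Q)|\ge|N_S(R)|$ for all $R$ $\mathcal{F}$-isomorphic to $Q$; $\mathcal{F}$-centric if $C_S(R)=Z(R)$ for all $R$ $\mathcal{F}$-isomorphic to $Q$; $\mathcal{F}$-radical if $O_p(\mathrm{Out}_{\mathcal{F}}(Q))=1$, where $\mathrm{Out}_{\mathcal{F}}(Q)=\mathrm{Aut}_{\mathcal{F}}(Q)/\mathrm{Inn}(Q)$; $\mathcal{F}$-essential if it is fully $\mathcal{F}$-normalised, $\mathcal{F}$-centric and $\mathrm{Out}_{\mathcal{F}}(Q)$ has a strongly $p$-embedded subgroup. $\mathcal{F}^{fcr}$ denotes the set of subgroups of $S$ that are fully $\mathcal{F}$-normalised, $\mathcal{F}$-centric and $\mathcal{F}$-radical. $N_{\mathcal{F}}(Q)$ is the fusion system over $N_S(Q)$ whose morphisms $U\to V$ are those $\varphi\in\mathrm{Hom}_{\mathcal{F}}(U,V)$ having an extension $\tilde\varphi\in\mathrm{Hom}_{\mathcal{F}}(UQ,VQ)$ with $\tilde\varphi(Q)=Q$; $Q$ is normal in $\mathcal{F}$ if $N_{\mathcal{F}}(Q)=\mathcal{F}$,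 and $O_p(\mathcal{F})$ is the largest subgroup of $S$ normal in $\mathcal{F}$. The local rank is defined recursively: $\mathrm{rank}_l(\mathcal{F})=0$ if $O_p(\mathcal{F})=S$; if $O_p(\mathcal{F})<S$, then $\mathrm{rank}_l(\mathcal{F})=1+\max\{\mathrm{rank}_l(N_{\mathcal{F}}(R)) : R\in\mathcal{F}^{fcr},\ O_p(\mathcal{F})<R\}$. *)

theory Defs
  imports "HOL-Algebra.Algebra"
begin

section \<open>Finite groups\<close>

locale finite_p_group = group G for p :: nat and G (structure) +
  assumes prime_p: "Factorial_Ring.prime p"
    and order_p_power: "\<exists>n. order G = p ^ n"

definition p_core :: "nat \<Rightarrow> ('a, 'b) monoid_scheme \<Rightarrow> 'a set" where
  "p_core p G = (GREATEST N. N \<lhd> G \<and> (\<exists>n. card N = p ^ n))"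

definition sylow_subgroup :: "nat \<Rightarrow> ('a, 'b) monoid_scheme \<Rightarrow> 'a set \<Rightarrow> bool" where
  "sylow_subgroup p G H \<longleftrightarrow> subgroup H G \<and> card H = p ^ multiplicity p (order G)"

definition strongly_p_embedded :: "nat \<Rightarrow> ('a, 'b) monoid_scheme \<Rightarrow> 'a set \<Rightarrow> bool" where
  "strongly_p_embedded p G H \<longleftrightarrow>
     subgroup H G \<and> H \<noteq> carrier G \<and> p dvd card H \<and>
     (\<forall>g \<in> carrier G - H. \<not> p dvd card (H \<inter> (g <#\<^bsub>G\<^esub> H #>\<^bsub>G\<^esub> inv\<^bsub>G\<^esub> g)))"

definition centraliser :: "('a, 'b) monoid_scheme \<Rightarrow> 'a set \<Rightarrow> 'a set" where
  "centraliser G H = {g \<in> carrier G. \<forall>h \<in> H. g \<otimes>\<^bsub>G\<^esub> h = h \<otimes>\<^bsub>G\<^esub> g}"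

definition centre :: "('a, 'b) monoid_scheme \<Rightarrow> 'a set \<Rightarrow> 'a set" where
  "centre G H = centraliser (G\<lparr>carrier := H\<rparr>) H"

definition conj_map :: "('a, 'b) monoid_scheme \<Rightarrow> 'a set \<Rightarrow> 'a \<Rightarrow> 'a \<Rightarrow> 'a" where
  "conj_map G P g = (\<lambda>x\<in>P. g \<otimes>\<^bsub>G\<^esub> x \<otimes>\<^bsub>G\<^esub> inv\<^bsub>G\<^esub> g)"

text \<open>The maps from \<open>P\<close> to \<open>Q\<close> induced by conjugation with elements of \<open>H\<close>. In a finite group
  \<open>G\<close>, \<open>conj_homs G (carrier G) P P\<close> is $\mathrm{Aut}_G(P)$ and \<open>conj_homs G P P P\<close> is
  $\mathrm{Inn}(P)$.\<close>

definition conj_homs ::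
    "('a, 'b) monoid_scheme \<Rightarrow> 'a set \<Rightarrow> 'a set \<Rightarrow> 'a set \<Rightarrow> ('a \<Rightarrow> 'a) set" where
  "conj_homs G H P Q = {conj_map G P g | g. g \<in> H \<and> conj_map G P g ` P \<subseteq> Q}"


section \<open>Fusion systems\<close>

text \<open>A fusion system over \<open>S\<close> is given by its morphism sets: \<open>F P Q\<close> is
  $\mathrm{Hom}_{\mathcal{F}}(P,Q)$. Morphisms are extensional functions, so that they are determined
  by their values on the source. The objects are the subgroups of \<open>S\<close>; morphism sets at other
  arguments are empty, which makes equality of fusion systems over \<open>S\<close> plain equality.\<close>

type_synonym 'a hom_system = "'a set \<Rightarrow> 'a set \<Rightarrow> ('a \<Rightarrow> 'a) set"

definition fs_isos :: "'a hom_system \<Rightarrow> 'a set \<Rightarrow> 'a set \<Rightarrow> ('a \<Rightarrow> 'a) set" where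
  "fs_isos F P Q =
     {\<phi> \<in> F P Q. bij_betw \<phi> P Q \<and> restrict (inv_into P \<phi>) Q \<in> F Q P}"

definition fs_isomorphic :: "'a hom_system \<Rightarrow> 'a set \<Rightarrow> 'a set \<Rightarrow> bool" where
  "fs_isomorphic F P Q \<longleftrightarrow> fs_isos F P Q \<noteq> {}"

locale fusion_system = finite_p_group p S for p :: nat and S (structure) +
  fixes F :: "'a hom_system"
  assumes objects: "\<phi> \<in> F P Q \<Longrightarrow> subgroup P S \<and> subgroup Q S"
    and conj_in: "\<lbrakk>subgroup P S; subgroup Q S\<rbrakk> \<Longrightarrow> conj_homs S (carrier S) P Q \<subseteq> F P Q"
    and inj_hom: "F P Q \<subseteq> mon (S\<lparr>carrier := P\<rparr>) (S\<lparr>carrier := Q\<rparr>) \<inter> extensional P"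
    and comp: "\<lbrakk>\<phi> \<in> F P Q; \<psi> \<in> F Q R\<rbrakk> \<Longrightarrow> compose P \<psi> \<phi> \<in> F P R"
    and iso_onto_image: "\<phi> \<in> F P Q \<Longrightarrow> \<phi> \<in> fs_isos F P (\<phi> ` P)"

definition aut_group :: "'a hom_system \<Rightarrow> 'a set \<Rightarrow> ('a \<Rightarrow> 'a) monoid" where
  "aut_group F Q = BijGroup Q\<lparr>carrier := F Q Q\<rparr>"

definition out_group :: "('a, 'b) monoid_scheme \<Rightarrow> 'a hom_system \<Rightarrow> 'a set \<Rightarrow> ('a \<Rightarrow> 'a) set monoid" where
  "out_group S F Q = aut_group F Q Mod conj_homs S Q Q Q"

definition fully_normalised :: "('a, 'b) monoid_scheme \<Rightarrow> 'a hom_system \<Rightarrow> 'a set \<Rightarrow> bool" where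
  "fully_normalised S F Q \<longleftrightarrow>
     (\<forall>R. fs_isomorphic F Q R \<longrightarrow> card (normalizer S R) \<le> card (normalizer S Q))"

definition fully_centralised :: "('a, 'b) monoid_scheme \<Rightarrow> 'a hom_system \<Rightarrow> 'a set \<Rightarrow> bool" where
  "fully_centralised S F Q \<longleftrightarrow>
     (\<forall>R. fs_isomorphic F Q R \<longrightarrow> card (centraliser S R) \<le> card (centraliser S Q))"

text \<open>$N_\varphi = \{g \in N_S(P) \mid \varphi c_g \varphi^{-1} \in \mathrm{Aut}_S(\varphi(P))\}$\<close>

definition extension_domain ::
    "('a, 'b) monoid_scheme \<Rightarrow> 'a set \<Rightarrow> ('a \<Rightarrow> 'a) \<Rightarrow> 'a set" where
  "extension_domain S P \<phi> = {g \<in> normalizer S P.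
     compose (\<phi> ` P) \<phi> (compose (\<phi> ` P) (conj_map S P g) (inv_into P \<phi>))
       \<in> conj_homs S (carrier S) (\<phi> ` P) (\<phi> ` P)}"

text \<open>Saturation in the sense of Broto, Levi and Oliver.\<close>

locale saturated_fusion_system = fusion_system +
  assumes fully_normalised_sylow:
      "\<lbrakk>subgroup P S; fully_normalised S F P\<rbrakk> \<Longrightarrow>
         fully_centralised S F P \<and>
         sylow_subgroup p (aut_group F P) (conj_homs S (carrier S) P P)"
    and extension:
      "\<lbrakk>\<phi> \<in> F P (carrier S); fully_centralised S F (\<phi> ` P)\<rbrakk> \<Longrightarrow>
         \<exists>\<psi> \<in> F (extension_domain S P \<phi>) (carrier S). restrict \<psi> P = \<phi>"

definition fs_centric :: "('a, 'b) monoid_scheme \<Rightarrow> 'a hom_system \<Rightarrow> 'a set \<Rightarrow> bool" where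
  "fs_centric S F Q \<longleftrightarrow> (\<forall>R. fs_isomorphic F Q R \<longrightarrow> centraliser S R = centre S R)"

definition fs_radical :: "nat \<Rightarrow> ('a, 'b) monoid_scheme \<Rightarrow> 'a hom_system \<Rightarrow> 'a set \<Rightarrow> bool" where
  "fs_radical p S F Q \<longleftrightarrow> p_core p (out_group S F Q) = {\<one>\<^bsub>out_group S F Q\<^esub>}"

definition fcr_subgroups :: "nat \<Rightarrow> ('a, 'b) monoid_scheme \<Rightarrow> 'a hom_system \<Rightarrow> 'a set set" where
  "fcr_subgroups p S F =
     {Q. subgroup Q S \<and> fully_normalised S F Q \<and> fs_centric S F Q \<and> fs_radical p S F Q}"

definition essential_subgroups :: "nat \<Rightarrow> ('a, 'b) monoid_scheme \<Rightarrow> 'a hom_system \<Rightarrow> 'a set set" where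
  "essential_subgroups p S F =
     {Q. subgroup Q S \<and> fully_normalised S F Q \<and> fs_centric S F Q \<and>
         (\<exists>H. strongly_p_embedded p (out_group S F Q) H)}"

definition normaliser_group ::
    "('a, 'b) monoid_scheme \<Rightarrow> 'a set \<Rightarrow> ('a, 'b) monoid_scheme" where
  "normaliser_group S Q = S\<lparr>carrier := normalizer S Q\<rparr>"

text \<open>$N_{\mathcal{F}}(Q)$, as a fusion system over \<open>normaliser_group S Q\<close>\<close>

definition normaliser_system ::
    "('a, 'b) monoid_scheme \<Rightarrow> 'a hom_system \<Rightarrow> 'a set \<Rightarrow> 'a hom_system" where
  "normaliser_system S F Q U V =
     {\<phi> \<in> F U V. subgroup U (normaliser_group S Q) \<and> subgroup V (normaliser_group S Q) \<and>
        (\<exists>\<psi> \<in> F (U <#>\<^bsub>S\<^esub> Q) (V <#>\<^bsub>S\<^esub> Q). \<psi> ` Q = Q \<and> restrict \<psi> U = \<phi>)}"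

definition fs_normal :: "('a, 'b) monoid_scheme \<Rightarrow> 'a hom_system \<Rightarrow> 'a set \<Rightarrow> bool" where
  "fs_normal S F Q \<longleftrightarrow>
     subgroup Q S \<and> normalizer S Q = carrier S \<and> normaliser_system S F Q = F"

text \<open>$O_p(\mathcal{F})$\<close>

definition fs_core :: "('a, 'b) monoid_scheme \<Rightarrow> 'a hom_system \<Rightarrow> 'a set" where
  "fs_core S F = (GREATEST Q. fs_normal S F Q)"


section \<open>Local rank\<close>

text \<open>Termination of the recursion below needs that \<open>fs_core\<close> is well defined: a subgroup
  properly containing it is then not normal, so its normaliser system has fewer morphisms.\<close>

lemma (in group) normalizer_mem_iff:
  assumes "H \<subseteq> carrier G"
  shows "g \<in> normalizer G H \<longleftrightarrow> g \<in> carrier G \<and> g <# H #> inv g = H"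
  using assms by (auto simp: normalizer_def stabilizer_def)

lemma (in group) normalizer_eq_carrier_iff:
  assumes "subgroup H G"
  shows "normalizer G H = carrier G \<longleftrightarrow> H \<lhd> G"
proof
  assume eq: "normalizer G H = carrier G"
  have "H \<lhd> G\<lparr>carrier := normalizer G H\<rparr>"
    by (rule subgroup_in_normalizer[OF assms])
  then show "H \<lhd> G" using eq by simp
next
  assume N: "H \<lhd> G"
  have sub: "H \<subseteq> carrier G" using assms by (rule subgroup.subset)
  have "g <# H #> inv g = H" if g: "g \<in> carrier G" for g
    using g sub N normal.coset_eq[OF N]
    by (metis coset_mult_assoc coset_mult_one inv_closed r_inv)
  then show "normalizer G H = carrier G"
    using normalizer_mem_iff[OF sub] by auto
qed

context fusion_system
begin

lemma finite_S: "finite (carrier S)"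
proof -
  have "order S > 0" using order_p_power prime_p by (auto simp: prime_gt_0_nat)
  then show ?thesis unfolding order_def using card_gt_0_iff by blast
qed

lemma hom_mult:
  assumes "\<phi> \<in> F P Q" "x \<in> P" "y \<in> P"
  shows "\<phi> (x \<otimes> y) = \<phi> x \<otimes> \<phi> y"
  using inj_hom assms by (fastforce simp: mon_def hom_def)

lemma hom_ext: "\<phi> \<in> F P Q \<Longrightarrow> \<phi> \<in> extensional P"
  using inj_hom by blast

lemma hom_img: "\<phi> \<in> F P Q \<Longrightarrow> \<phi> ` P \<subseteq> Q"
  using inj_hom by (fastforce simp: mon_def hom_def)

lemma normaliser_system_le: "normaliser_system S F Q U V \<subseteq> F U V"
  by (auto simp: normaliser_system_def)

lemma finite_homs: "finite {(P, Q, \<phi>). \<phi> \<in> F P Q}"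
proof (rule finite_subset)
  let ?A = "Pow (carrier S)"
  let ?M = "\<Union>P\<in>?A. P \<rightarrow>\<^sub>E carrier S"
  show "{(P, Q, \<phi>). \<phi> \<in> F P Q} \<subseteq> ?A \<times> ?A \<times> ?M"
  proof
    fix x assume "x \<in> {(P, Q, \<phi>). \<phi> \<in> F P Q}"
    then obtain P Q \<phi> where x: "x = (P, Q, \<phi>)" and h: "\<phi> \<in> F P Q" by auto
    have P: "P \<subseteq> carrier S" and Q: "Q \<subseteq> carrier S"
      using objects[OF h] by (auto dest: subgroup.subset)
    then have "\<phi> \<in> P \<rightarrow>\<^sub>E carrier S"
      using hom_ext[OF h] hom_img[OF h] by (auto simp: PiE_def)
    then show "x \<in> ?A \<times> ?A \<times> ?M"
      using P Q x by auto
  qed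
  have "finite (P \<rightarrow>\<^sub>E carrier S)" if "P \<in> ?A" for P
    using that finite_S by (auto intro!: finite_PiE intro: finite_subset)
  then show "finite (?A \<times> ?A \<times> ?M)"
    using finite_S by auto
qed

lemma fs_normalI:
  assumes Q: "Q \<lhd> S"
    and ext: "\<And>U V \<phi>. \<phi> \<in> F U V \<Longrightarrow>
      \<exists>\<psi> \<in> F (U <#> Q) (V <#> Q). \<psi> ` Q = Q \<and> restrict \<psi> U = \<phi>"
  shows "fs_normal S F Q"
proof -
  have sub: "subgroup Q S" using Q by (rule normal_imp_subgroup)
  have N: "normalizer S Q = carrier S" using Q sub normalizer_eq_carrier_iff by blast
  then have "normaliser_group S Q = S" by (simp add: normaliser_group_def)
  then have "normaliser_system S F Q U V = F U V" for U V
    using ext objects by (auto simp: normaliser_system_def)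
  then show ?thesis using sub N by (simp add: fs_normal_def fun_eq_iff)
qed

lemma fs_normalD:
  assumes "fs_normal S F Q"
  shows "Q \<lhd> S"
    and "\<phi> \<in> F U V \<Longrightarrow> \<exists>\<psi> \<in> F (U <#> Q) (V <#> Q). \<psi> ` Q = Q \<and> restrict \<psi> U = \<phi>"
proof -
  show "Q \<lhd> S" using assms normalizer_eq_carrier_iff by (auto simp: fs_normal_def)
  assume "\<phi> \<in> F U V"
  then have "\<phi> \<in> normaliser_system S F Q U V" using assms by (simp add: fs_normal_def)
  then show "\<exists>\<psi> \<in> F (U <#> Q) (V <#> Q). \<psi> ` Q = Q \<and> restrict \<psi> U = \<phi>"
    by (simp add: normaliser_system_def)
qed

lemma fs_normal_one: "fs_normal S F {\<one>}"
proof (rule fs_normalI)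
  show "{\<one>} \<lhd> S" by (rule one_is_normal)
  fix U V \<phi> assume h: "\<phi> \<in> F U V"
  have U: "subgroup U S" and V: "subgroup V S" using objects[OF h] by auto
  have eq: "U <#> {\<one>} = U" "V <#> {\<one>} = V"
    using U V by (metis coset_mult_one r_coset_eq_set_mult subgroup.subset)+
  have one: "\<one> \<in> U" using U by (rule subgroup.one_closed)
  have "\<phi> \<one> \<otimes> \<phi> \<one> = \<phi> \<one>" using hom_mult[OF h one one] by simp
  moreover have "\<phi> \<one> \<in> carrier S"
    using hom_img[OF h] one subgroup.subset[OF V] by blast
  ultimately have "\<phi> \<one> = \<one>" by simp
  moreover have "restrict \<phi> U = \<phi>" using hom_ext[OF h] by (rule extensional_restrict)
  ultimately show "\<exists>\<psi> \<in> F (U <#> {\<one>}) (V <#> {\<one>}). \<psi> ` {\<one>} = {\<one>} \<and> restrict \<psi> U = \<phi>"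
    using h eq by auto
qed

lemma fs_normal_mult:
  assumes Q: "fs_normal S F Q" and R: "fs_normal S F R"
  shows "fs_normal S F (Q <#> R)"
proof (rule fs_normalI)
  note QN = fs_normalD(1)[OF Q] and RN = fs_normalD(1)[OF R]
  have Qs: "Q \<subseteq> carrier S" and Rs: "R \<subseteq> carrier S"
    using QN RN by (auto dest: normal_imp_subgroup subgroup.subset)
  have Q1: "\<one> \<in> Q" and R1: "\<one> \<in> R"
    using QN RN by (auto dest: normal_imp_subgroup subgroup.one_closed)
  show "Q <#> R \<lhd> S"
    by (metis QN RN normal_subgroup_set_mult_closed)
  fix U V \<phi> assume h: "\<phi> \<in> F U V"
  have U: "subgroup U S" and V: "subgroup V S" using objects[OF h] by auto
  note Us = subgroup.subset[OF U] and Vs = subgroup.subset[OF V]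
  obtain \<psi> where \<psi>: "\<psi> \<in> F (U <#> Q) (V <#> Q)" "\<psi> ` Q = Q" "restrict \<psi> U = \<phi>"
    using fs_normalD(2)[OF Q h] by blast
  obtain \<chi> where \<chi>: "\<chi> \<in> F (U <#> Q <#> R) (V <#> Q <#> R)" "\<chi> ` R = R"
      "restrict \<chi> (U <#> Q) = \<psi>"
    using fs_normalD(2)[OF R \<psi>(1)] by blast
  have UQ: "U \<subseteq> U <#> Q" "Q \<subseteq> U <#> Q"
    using Us Qs Q1 subgroup.one_closed[OF U] r_one l_one unfolding set_mult_def by (force, force)
  have UQs: "U <#> Q \<subseteq> carrier S" using Us Qs by (rule set_mult_closed)
  have UQR: "U <#> Q \<subseteq> U <#> Q <#> R"
    using UQs R1 r_one unfolding set_mult_def[of S "U <#> Q"] by force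
  have U1: "\<one> \<in> U <#> Q" using UQ(1) subgroup.one_closed[OF U] by blast
  have RR: "R \<subseteq> U <#> Q <#> R"
    using U1 Rs l_one unfolding set_mult_def[of S "U <#> Q"] by force
  have "\<chi> ` Q = Q"
    using \<chi>(3) \<psi>(2) UQ(2) by (metis image_restrict_eq inf.absorb_iff2 restrict_apply' image_cong subsetD)
  have "\<chi> ` (Q <#> R) = \<chi> ` Q <#> \<chi> ` R"
  proof -
    have "\<chi> (x \<otimes> y) = \<chi> x \<otimes> \<chi> y" if "x \<in> Q" "y \<in> R" for x y
      using hom_mult[OF \<chi>(1)] that UQ(2) UQR RR by blast
    then show ?thesis unfolding set_mult_def by (auto simp: image_UN)
  qed
  then have img: "\<chi> ` (Q <#> R) = Q <#> R" using \<open>\<chi> ` Q = Q\<close> \<chi>(2) by simp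
  have res: "restrict \<chi> U = \<phi>"
    using \<chi>(3) \<psi>(3) UQ(1) by (metis restrict_restrict inf.absorb_iff2)
  have "\<chi> \<in> F (U <#> (Q <#> R)) (V <#> (Q <#> R))"
    using \<chi>(1) by (simp add: set_mult_assoc Us Vs Qs Rs)
  then show "\<exists>\<psi> \<in> F (U <#> (Q <#> R)) (V <#> (Q <#> R)).
      \<psi> ` (Q <#> R) = Q <#> R \<and> restrict \<psi> U = \<phi>"
    using img res by blast
qed

lemma fs_core_greatest:
  shows fs_core_normal: "fs_normal S F (fs_core S F)"
    and fs_core_upper: "fs_normal S F R \<Longrightarrow> R \<subseteq> fs_core S F"
proof -
  let ?A = "{Q. fs_normal S F Q}"
  have subs: "Q \<subseteq> carrier S" if "fs_normal S F Q" for Q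
    using that by (auto simp: fs_normal_def dest: subgroup.subset)
  then have fin: "finite ?A"
    using finite_S by (auto intro: finite_subset[of _ "Pow (carrier S)"])
  have "\<exists>Q. Q \<in> ?A \<and> (\<forall>R\<in>?A. Q \<subseteq> R \<longrightarrow> Q = R)"
    using finite_has_maximal[OF fin] fs_normal_one by blast
  then obtain Q where Q: "fs_normal S F Q"
    and max: "\<And>R. fs_normal S F R \<Longrightarrow> Q \<subseteq> R \<Longrightarrow> Q = R" by blast
  have up: "R \<subseteq> Q" if R: "fs_normal S F R" for R
  proof -
    have "\<one> \<in> Q" "\<one> \<in> R"
      using Q R by (auto simp: fs_normal_def dest: subgroup.one_closed)
    then have "Q \<subseteq> Q <#> R" "R \<subseteq> Q <#> R"
      using subs[OF Q] subs[OF R] r_one l_one unfolding set_mult_def by (force, force)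
    then show ?thesis using max[OF fs_normal_mult[OF Q R]] by blast
  qed
  have "fs_core S F = Q"
    unfolding fs_core_def using Q up by (intro Greatest_equality) auto
  then show "fs_normal S F (fs_core S F)" "fs_normal S F R \<Longrightarrow> R \<subseteq> fs_core S F"
    using Q up by auto
qed

lemma normaliser_system_smaller:
  assumes R: "subgroup R S" and less: "fs_core S F \<subset> R"
  shows "card {(P, Q, \<phi>). \<phi> \<in> normaliser_system S F R P Q} < card {(P, Q, \<phi>). \<phi> \<in> F P Q}"
proof (rule psubset_card_mono[OF finite_homs])
  have not_normal: "\<not> fs_normal S F R"
    using fs_core_upper less by blast
  have "normaliser_system S F R \<noteq> F"
  proof
    assume eq: "normaliser_system S F R = F"
    have "conj_map S (carrier S) \<one> \<in> conj_homs S (carrier S) (carrier S) (carrier S)"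
      unfolding conj_homs_def by (auto simp: conj_map_def intro!: exI[of _ \<one>])
    then have "conj_map S (carrier S) \<one> \<in> F (carrier S) (carrier S)"
      using conj_in subgroup_self by blast
    then have "subgroup (carrier S) (normaliser_group S R)"
      using eq by (metis (no_types, lifting) mem_Collect_eq normaliser_system_def)
    then have "carrier S \<subseteq> normalizer S R"
      using subgroup.subset by (fastforce simp: normaliser_group_def)
    moreover have "normalizer S R \<subseteq> carrier S"
      using normalizer_mem_iff subgroup.subset[OF R] by blast
    ultimately show False using not_normal eq R by (auto simp: fs_normal_def)
  qed
  then obtain P Q where "normaliser_system S F R P Q \<noteq> F P Q" by blast
  then obtain \<phi> where "\<phi> \<in> F P Q" "\<phi> \<notin> normaliser_system S F R P Q"
    using normaliser_system_le by blast
  then show "{(P, Q, \<phi>). \<phi> \<in> normaliser_system S F R P Q} \<subset> {(P, Q, \<phi>). \<phi> \<in> F P Q}"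
    using normaliser_system_le by blast
qed

end

text \<open>The guard \<open>fusion_system p S F\<close> only serves to make the recursion total; the value outside it
  is irrelevant, since normaliser systems are fusion systems.\<close>

function local_rank :: "nat \<Rightarrow> ('a, 'b) monoid_scheme \<Rightarrow> 'a hom_system \<Rightarrow> nat" where
  "local_rank p S F =
     (if fusion_system p S F \<and> fs_core S F \<noteq> carrier S
      then 1 + Max ((\<lambda>R. local_rank p (normaliser_group S R) (normaliser_system S F R)) `
                    {R \<in> fcr_subgroups p S F. fs_core S F \<subset> R})
      else 0)"
  by pat_completeness auto
termination
  by (relation "measure (\<lambda>(p, S, F). card {(P, Q, \<phi>). \<phi> \<in> F P Q})")
    (auto simp: fcr_subgroups_def intro: fusion_system.normaliser_system_smaller)

declare local_rank.simps [simp del]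

end

theory Submission
  imports Defs
begin

text \<open>
  Let \<open>Q\<close> be the core $O_p(\mathcal{F})$. Two principles give the equivalence.

  The first is an extension principle in the style of Alperin's fusion theorem
  (\<open>extends_if_no_essential\<close>): if a family of subgroups is closed under $\mathcal{F}$-conjugation and
  overgroups and contains no essential subgroup, then every morphism out of a member extends to an
  automorphism of \<open>S\<close>. The reason is that, if all morphisms out of larger subgroups extend but not all
  automorphisms of a fully normalised centric \<open>R\<close> do, then those that do extend give a strongly embedded
  subgroup of $\mathrm{Out}_{\mathcal{F}}(R)$.

  The second is an obstruction (\<open>radical_centric_extensions\<close>): if \<open>R\<close> is centric and radical, and all
  automorphisms of \<open>R\<close> extend to automorphisms of some \<open>D\<close> with $R \le D \le N_S(R)$, then \<open>D = R\<close>, because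
  $\mathrm{Aut}_D(R)$ is a normal \<open>p\<close>-subgroup of $\mathrm{Aut}_{\mathcal{F}}(R)$. In particular, if the
  automorphisms of \<open>R\<close> extend to $N_S(R)$, then $N_S(R) = R$ and hence \<open>R = S\<close>.

  The local rank is \<open>1\<close> iff \<open>Q < S\<close> and, for every fully normalised centric radical \<open>R > Q\<close>, the core of
  $N_{\mathcal{F}}(R)$ is $N_S(R)$. Suppose that this holds. An essential subgroup \<open>E\<close> is radical, since a
  group with a strongly embedded subgroup has no non-trivial normal \<open>p\<close>-subgroup; by the obstruction with
  $D = N_{EQ}(E)$ it contains \<open>Q\<close>. If \<open>E > Q\<close>, the automorphisms of \<open>E\<close> extend to $N_S(E)$, so \<open>E = S\<close>; but
  \<open>S\<close> is not essential, as $\mathrm{Out}_{\mathcal{F}}(S)$ has order prime to \<open>p\<close>. Hence \<open>Q\<close> is the only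
  candidate, and it is essential because otherwise the extension principle for all subgroups would make
  \<open>S\<close> normal in $\mathcal{F}$. Conversely, if \<open>Q\<close> is the only essential subgroup, the extension principle
  applies to the subgroups properly containing \<open>Q\<close>. So for a centric radical \<open>R > Q\<close> the automorphisms
  of \<open>R\<close> extend to \<open>S\<close>, hence to $N_S(R)$, and \<open>R = S\<close>; and \<open>S\<close> is the core of $N_{\mathcal{F}}(S)$.
\<close>

section \<open>Fixed points of p-groups and Sylow theory\<close>

text \<open>Every orbit that is not a fixed point has size a non-trivial power of \<open>p\<close>. All of the Sylow theory
  below comes from this count.\<close>

lemma (in group_action) card_mod_fixed_points:
  assumes p: "Factorial_Ring.prime p" and ord: "order G = p ^ n" and fin: "finite E"
  shows "card E mod p = card {x \<in> E. \<forall>g \<in> carrier G. \<phi> g x = x} mod p"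
proof -
  interpret G: group G using group_hom group_hom.axioms(1) by auto
  define Fix where "Fix = {x \<in> E. \<forall>g \<in> carrier G. \<phi> g x = x}"
  have orbE: "orbit G \<phi> x \<subseteq> E" if "x \<in> E" for x
    using that element_image by (auto simp: orbit_def)
  have large: "p dvd card (orbit G \<phi> x)" if x: "x \<in> E" "x \<notin> Fix" for x
  proof -
    have "card (orbit G \<phi> x) dvd p ^ n"
      using orbit_stabilizer_theorem[OF x(1)] ord by (metis dvd_triv_left)
    then obtain k where k: "card (orbit G \<phi> x) = p ^ k"
      using p by (auto simp: divides_primepow_nat)
    have "k \<noteq> 0"
    proof
      assume "k = 0"
      then obtain y where "orbit G \<phi> x = {y}" using k card_1_singletonE by auto
      then have "orbit G \<phi> x = {x}" using orbit_refl[OF x(1)] by auto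
      then have "\<forall>g \<in> carrier G. \<phi> g x = x" by (auto simp: orbit_def)
      then show False using x by (auto simp: Fix_def)
    qed
    then show ?thesis using k by simp
  qed
  have single: "orbit G \<phi> x = {x}" if "x \<in> Fix" for x
    using that G.one_closed unfolding orbit_def Fix_def by (auto intro!: exI[of _ "\<one>"])
  have part: "partition E (orbits G E \<phi>)" by (rule orbit_partition)
  define B where "B = (\<lambda>x. orbit G \<phi> x) ` (E - Fix)"
  have un: "\<Union>B = E - Fix"
  proof
    show "E - Fix \<subseteq> \<Union>B" using orbit_refl by (auto simp: B_def)
    show "\<Union>B \<subseteq> E - Fix"
    proof
      fix y assume "y \<in> \<Union>B"
      then obtain x where x: "x \<in> E - Fix" "y \<in> orbit G \<phi> x" by (auto simp: B_def)
      then have y: "y \<in> E" using orbE by blast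
      have "x \<in> orbit G \<phi> y" using orbit_sym x y by blast
      then show "y \<in> E - Fix" using single x y by fastforce
    qed
  qed
  have "disjoint B"
  proof (rule disjointI)
    fix a b assume ab: "a \<in> B" "b \<in> B" "a \<noteq> b"
    show "a \<inter> b = {}"
    proof (rule ccontr)
      assume "a \<inter> b \<noteq> {}"
      then obtain z where z: "z \<in> a" "z \<in> b" by blast
      have "z \<in> E" using ab z un by blast
      have "a \<in> orbits G E \<phi>" "b \<in> orbits G E \<phi>" using ab by (auto simp: B_def orbits_def)
      then show False
        using partition.unique_class[OF part \<open>z \<in> E\<close>] z ab(3) by blast
    qed
  qed
  then have "card (E - Fix) = sum card B"
    unfolding un[symmetric] using finite_subset[OF orbE fin]
    by (intro card_Union_disjoint) (auto simp: B_def disjoint_def pairwise_def disjnt_def)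
  then have "p dvd card (E - Fix)"
    using large by (auto simp: B_def intro!: dvd_sum)
  moreover have "card E = card (E - Fix) + card Fix"
    using fin by (subst card_Un_disjoint[symmetric]) (auto simp: Fix_def intro: arg_cong[where f=card])
  ultimately show ?thesis unfolding Fix_def[symmetric] by (auto simp: mod_add_left_eq elim!: dvdE)
qed

context group
begin

text \<open>The inverse turns right translation into a left action.\<close>

lemma right_translation_action:
  assumes T: "subgroup T G" and K: "subgroup K G"
  shows "group_action (G\<lparr>carrier := K\<rparr>) (rcosets T) (\<lambda>k. \<lambda>C\<in>rcosets T. C #> inv k)"
proof -
  note Ks = subgroup.subset[OF K]
  have sub: "C \<subseteq> carrier G" if "C \<in> rcosets T" for C
    using that subgroup.subset[OF T] by (auto simp: RCOSETS_def r_coset_def)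
  have cl: "C #> g \<in> rcosets T" if C: "C \<in> rcosets T" and g: "g \<in> carrier G" for C g
  proof -
    obtain a where a: "a \<in> carrier G" "C = T #> a" using C by (auto simp: RCOSETS_def)
    then have "C #> g = T #> (a \<otimes> g)" using g subgroup.subset[OF T] by (simp add: coset_mult_assoc)
    then show ?thesis using a g subgroup.subset[OF T] by (auto intro: rcosetsI)
  qed
  have bij: "(\<lambda>C\<in>rcosets T. C #> inv k) \<in> Bij (rcosets T)" if k: "k \<in> K" for k
  proof -
    have kc: "k \<in> carrier G" using k Ks by blast
    have "bij_betw (\<lambda>C. C #> inv k) (rcosets T) (rcosets T)"
      by (rule bij_betw_byWitness[where f' = "\<lambda>C. C #> k"])
        (use kc cl sub in \<open>auto simp: coset_mult_assoc\<close>)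
    then show ?thesis by (simp add: Bij_def)
  qed
  have hom: "(\<lambda>k. \<lambda>C\<in>rcosets T. C #> inv k) \<in> hom (G\<lparr>carrier := K\<rparr>) (BijGroup (rcosets T))"
  proof (rule homI)
    fix k assume "k \<in> carrier (G\<lparr>carrier := K\<rparr>)"
    then show "(\<lambda>C\<in>rcosets T. C #> inv k) \<in> carrier (BijGroup (rcosets T))"
      using bij by (simp add: BijGroup_def)
  next
    fix k l assume "k \<in> carrier (G\<lparr>carrier := K\<rparr>)" "l \<in> carrier (G\<lparr>carrier := K\<rparr>)"
    then have kl: "k \<in> K" "l \<in> K" and klc: "k \<in> carrier G" "l \<in> carrier G" using Ks by auto
    have "C #> inv (k \<otimes> l) = C #> inv l #> inv k" if "C \<in> rcosets T" for C
      using that klc sub by (simp add: coset_mult_assoc inv_mult_group)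
    then show "(\<lambda>C\<in>rcosets T. C #> inv (k \<otimes>\<^bsub>G\<lparr>carrier := K\<rparr>\<^esub> l)) =
        (\<lambda>C\<in>rcosets T. C #> inv k) \<otimes>\<^bsub>BijGroup (rcosets T)\<^esub> (\<lambda>C\<in>rcosets T. C #> inv l)"
      using bij kl klc cl by (auto simp: BijGroup_def compose_def fun_eq_iff)
  qed
  show ?thesis
    by (intro group_action.intro group_hom.intro group_hom_axioms.intro hom group_BijGroup
        subgroup_imp_group K)
qed

lemma rcoset_translate_iff:
  assumes T: "subgroup T G" and g: "g \<in> carrier G" and k: "k \<in> carrier G"
  shows "T #> g #> k = T #> g \<longleftrightarrow> g \<otimes> k \<otimes> inv g \<in> T"
proof -
  have Ts: "T \<subseteq> carrier G" using T by (rule subgroup.subset)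
  have "T #> g #> k = T #> g \<longleftrightarrow> T #> (g \<otimes> k) = T #> g"
    using Ts g k by (simp add: coset_mult_assoc)
  also have "\<dots> \<longleftrightarrow> T #> (g \<otimes> k \<otimes> inv g) = T"
    using Ts g k by (metis coset_mult_inv1 coset_mult_inv2 m_closed)
  also have "\<dots> \<longleftrightarrow> g \<otimes> k \<otimes> inv g \<in> T"
    using T g k by (metis coset_join1 coset_join2 inv_closed m_closed subgroup.subset)
  finally show ?thesis .
qed

text \<open>A coset \<open>T #> g\<close> is fixed by \<open>K\<close> exactly when \<open>g\<close> conjugates \<open>K\<close> into \<open>T\<close>. So the count of fixed
  points produces conjugating elements: one exists as soon as \<open>p\<close> does not divide the index of \<open>T\<close>.\<close>

lemma index_mod_fixed_cosets:
  assumes fin: "finite (carrier G)" and p: "Factorial_Ring.prime p"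
    and T: "subgroup T G" and K: "subgroup K G" and cK: "card K = p ^ n"
  shows "card (rcosets T) mod p =
    card {C \<in> rcosets T. \<exists>g \<in> carrier G. C = T #> g \<and> (\<forall>k \<in> K. g \<otimes> k \<otimes> inv g \<in> T)} mod p"
proof -
  interpret act: group_action "G\<lparr>carrier := K\<rparr>" "rcosets T" "\<lambda>k. \<lambda>C\<in>rcosets T. C #> inv k"
    using T K by (rule right_translation_action)
  have eq: "(\<forall>k \<in> K. T #> g #> inv k = T #> g) \<longleftrightarrow> (\<forall>k \<in> K. g \<otimes> k \<otimes> inv g \<in> T)"
    if g: "g \<in> carrier G" for g
  proof -
    have "(\<forall>k \<in> K. T #> g #> inv k = T #> g) \<longleftrightarrow> (\<forall>k \<in> K. T #> g #> k = T #> g)"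
      using K by (metis inv_inv subgroup.m_inv_closed subgroup.mem_carrier)
    then show ?thesis using rcoset_translate_iff[OF T g] K by (meson subgroup.mem_carrier)
  qed
  have "(\<forall>k \<in> K. C #> inv k = C) \<longleftrightarrow>
      (\<exists>g \<in> carrier G. C = T #> g \<and> (\<forall>k \<in> K. g \<otimes> k \<otimes> inv g \<in> T))" if "C \<in> rcosets T" for C
    using that eq unfolding RCOSETS_def by blast
  then have "{C \<in> rcosets T. \<forall>k \<in> carrier (G\<lparr>carrier := K\<rparr>). (\<lambda>C\<in>rcosets T. C #> inv k) C = C} =
     {C \<in> rcosets T. \<exists>g \<in> carrier G. C = T #> g \<and> (\<forall>k \<in> K. g \<otimes> k \<otimes> inv g \<in> T)}"
    by (intro Collect_cong conj_cong refl) simp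
  moreover have "finite (rcosets T)"
    using fin by (simp add: RCOSETS_def)
  ultimately show ?thesis
    using act.card_mod_fixed_points[OF p, of n] cK by (simp add: order_def)
qed

lemma card_subgroup_dvd:
  assumes H: "subgroup H G" and K: "subgroup K G" and le: "K \<subseteq> H"
  shows "card K dvd card H"
proof -
  have "subgroup K (G\<lparr>carrier := H\<rparr>)" using H K le by (simp add: subgroup_incl)
  then show ?thesis
    using group.lagrange[OF subgroup_imp_group[OF H], of K] by (simp add: order_def) (metis dvd_triv_right)
qed

lemma subgroup_card_p_power:
  assumes p: "Factorial_Ring.prime p" and H: "subgroup H G" and K: "subgroup K G" and le: "K \<subseteq> H"
    and card: "card H = p ^ n"
  shows "\<exists>m. card K = p ^ m"
  using card_subgroup_dvd[OF H K le] card p by (auto simp: divides_primepow_nat)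

lemma p_subgroup_hom_image:
  assumes h: "h \<in> hom G H" and H: "group H" and K: "subgroup K G" and p: "Factorial_Ring.prime p"
    and cK: "card K = p ^ n"
  shows "subgroup (h ` K) H" and "\<exists>m. card (h ` K) = p ^ m"
proof -
  interpret hom: group_hom G H h
    using h H by (intro group_hom.intro group_hom_axioms.intro is_group)
  show sub: "subgroup (h ` K) H" using K by (rule hom.subgroup_img_is_subgroup)
  interpret K: group_hom "G\<lparr>carrier := K\<rparr>" "H\<lparr>carrier := h ` K\<rparr>" h
    using h K H sub by (intro group_hom.intro group_hom_axioms.intro subgroup_imp_group
        group.subgroup_imp_group[OF H] homI) (auto simp: subgroup.mem_carrier[OF K])
  have "(G\<lparr>carrier := K\<rparr>) Mod kernel (G\<lparr>carrier := K\<rparr>) (H\<lparr>carrier := h ` K\<rparr>) h \<cong> H\<lparr>carrier := h ` K\<rparr>"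
    by (rule K.FactGroup_iso) simp
  then have "card (rcosets\<^bsub>G\<lparr>carrier := K\<rparr>\<^esub> kernel (G\<lparr>carrier := K\<rparr>) (H\<lparr>carrier := h ` K\<rparr>) h) = card (h ` K)"
    by (auto simp: is_iso_def iso_def FactGroup_def dest: bij_betw_same_card)
  moreover have "subgroup (kernel (G\<lparr>carrier := K\<rparr>) (H\<lparr>carrier := h ` K\<rparr>) h) (G\<lparr>carrier := K\<rparr>)"
    by (rule K.subgroup_kernel)
  ultimately have "card (h ` K) dvd p ^ n"
    using K.G.lagrange[of "kernel (G\<lparr>carrier := K\<rparr>) (H\<lparr>carrier := h ` K\<rparr>) h"] cK
    by (auto simp: order_def intro: dvdI[OF sym])
  then show "\<exists>m. card (h ` K) = p ^ m" using p by (auto simp: divides_primepow_nat)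
qed

lemma sylow_index_not_dvd:
  assumes fin: "finite (carrier G)" and p: "Factorial_Ring.prime p" and T: "sylow_subgroup p G T"
  shows "\<not> p dvd card (rcosets T)"
proof
  assume "p dvd card (rcosets T)"
  then obtain c where "card (rcosets T) = p * c" by blast
  then have "order G = p ^ Suc (multiplicity p (order G)) * c"
    using lagrange[of T] T by (simp add: sylow_subgroup_def mult_ac)
  moreover have "order G \<noteq> 0" using fin order_gt_0_iff_finite by auto
  ultimately show False
    using power_dvd_iff_le_multiplicity[of "order G" p "Suc (multiplicity p (order G))"] p
    by (metis Suc_n_not_le_n dvd_triv_left not_prime_unit)
qed

text \<open>The second Sylow theorem: the index of a Sylow subgroup is prime to \<open>p\<close>, so a \<open>p\<close>-group acting on its
  cosets fixes one of them.\<close>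

lemma p_subgroup_conjugate_into_sylow:
  assumes fin: "finite (carrier G)" and p: "Factorial_Ring.prime p" and T: "sylow_subgroup p G T"
    and K: "subgroup K G" and cK: "card K = p ^ n"
  shows "\<exists>g \<in> carrier G. \<forall>k \<in> K. g \<otimes> k \<otimes> inv g \<in> T"
proof -
  have "subgroup T G" using T by (simp add: sylow_subgroup_def)
  from index_mod_fixed_cosets[OF fin p this K cK] sylow_index_not_dvd[OF fin p T]
  have "{C \<in> rcosets T. \<exists>g \<in> carrier G. C = T #> g \<and> (\<forall>k \<in> K. g \<otimes> k \<otimes> inv g \<in> T)} \<noteq> {}"
    by (metis card.empty mod_0 mod_0_imp_dvd)
  then show ?thesis by blast
qed

lemma normal_p_subgroup_le_sylow:
  assumes fin: "finite (carrier G)" and p: "Factorial_Ring.prime p" and T: "sylow_subgroup p G T"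
    and N: "N \<lhd> G" and cN: "card N = p ^ n"
  shows "N \<subseteq> T"
proof
  fix x assume x: "x \<in> N"
  obtain g where g: "g \<in> carrier G" "\<forall>k \<in> N. g \<otimes> k \<otimes> inv g \<in> T"
    using p_subgroup_conjugate_into_sylow[OF fin p T normal_imp_subgroup[OF N] cN] by blast
  have "inv g \<otimes> x \<otimes> g \<in> N" using normal.inv_op_closed1[OF N g(1) x] .
  then have "g \<otimes> (inv g \<otimes> x \<otimes> g) \<otimes> inv g \<in> T" using g by blast
  moreover have "x \<in> carrier G" using x N by (meson normal_imp_subgroup subgroup.mem_carrier)
  ultimately show "x \<in> T" using g(1) by (metis inv_closed inv_solve_left m_assoc m_closed r_inv r_one)
qed

text \<open>Let \<open>T\<close> act on its own cosets. Their number is divisible by \<open>p\<close>, hence so is the number of fixed ones,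
  and besides \<open>T\<close> itself there is a second fixed coset; its representatives normalise \<open>T\<close>.\<close>

lemma normalizer_grows:
  assumes p: "Factorial_Ring.prime p" and ord: "order G = p ^ n"
    and T: "subgroup T G" and ne: "T \<noteq> carrier G"
  shows "\<exists>g \<in> normalizer G T. g \<notin> T"
proof -
  have fin: "finite (carrier G)"
    using ord p by (metis card.infinite order_def power_eq_0_iff not_prime_0)
  have Ts: "T \<subseteq> carrier G" using T by (rule subgroup.subset)
  have finT: "finite T" using Ts fin by (rule finite_subset)
  obtain m where m: "card T = p ^ m"
    using subgroup_card_p_power[OF p subgroup_self T Ts, of n] ord by (auto simp: order_def)
  let ?X = "{C \<in> rcosets T. \<exists>g \<in> carrier G. C = T #> g \<and> (\<forall>k \<in> T. g \<otimes> k \<otimes> inv g \<in> T)}"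
  have "card (rcosets T) dvd p ^ n" using lagrange[OF T] ord by (metis dvd_triv_left)
  then obtain j where j: "card (rcosets T) = p ^ j" using p by (auto simp: divides_primepow_nat)
  have "j \<noteq> 0"
  proof
    assume "j = 0"
    then have "card T = card (carrier G)" using lagrange[OF T] j by (simp add: order_def)
    then show False using ne Ts fin card_subset_eq by blast
  qed
  then have "card (rcosets T) mod p = 0" using j by simp
  then have "p dvd card ?X"
    using index_mod_fixed_cosets[OF fin p T T m] by (simp only: mod_eq_0_iff_dvd)
  moreover have "T \<in> ?X"
  proof -
    have "T = T #> \<one>" using Ts by simp
    moreover have "\<forall>k \<in> T. \<one> \<otimes> k \<otimes> inv \<one> \<in> T" using Ts by auto
    moreover have "T \<in> rcosets T" using subgroup.subgroup_in_rcosets[OF T is_group] .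
    ultimately show ?thesis by blast
  qed
  moreover have "finite ?X"
    using fin by (simp add: RCOSETS_def)
  ultimately have "?X \<noteq> {T}"
    using p by (auto simp: prime_nat_iff)
  then obtain g where g: "g \<in> carrier G" "T #> g \<noteq> T" "\<forall>k \<in> T. g \<otimes> k \<otimes> inv g \<in> T"
    using \<open>T \<in> ?X\<close> by blast
  have "g \<notin> T" using g T coset_join2 by blast
  moreover have "g \<in> normalizer G T"
  proof -
    have "(\<lambda>k. g \<otimes> k \<otimes> inv g) ` T = T"
    proof (rule endo_inj_surj[OF finT])
      show "(\<lambda>k. g \<otimes> k \<otimes> inv g) ` T \<subseteq> T" using g by blast
      show "inj_on (\<lambda>k. g \<otimes> k \<otimes> inv g) T" using Ts g(1)
        by (intro inj_onI) (meson inv_closed m_closed r_cancel l_cancel subsetD)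
    qed
    moreover have "g <# T #> inv g = (\<lambda>k. g \<otimes> k \<otimes> inv g) ` T"
      by (auto simp: l_coset_def r_coset_def)
    ultimately show ?thesis using normalizer_mem_iff[OF Ts] g(1) by simp
  qed
  ultimately show ?thesis by blast
qed

lemma normalizer_grows_within:
  assumes p: "Factorial_Ring.prime p" and P: "subgroup P G" and ord: "card P = p ^ n"
    and T: "subgroup T G" and less: "T \<subset> P"
  shows "\<exists>g \<in> normalizer G T \<inter> P. g \<notin> T"
proof -
  interpret P: group "G\<lparr>carrier := P\<rparr>" using P by (rule subgroup_imp_group)
  have Ts: "T \<subseteq> carrier G" using T by (rule subgroup.subset)
  have "subgroup T (G\<lparr>carrier := P\<rparr>)" using P T less by (intro subgroup_incl) auto
  then obtain g where g: "g \<in> normalizer (G\<lparr>carrier := P\<rparr>) T" "g \<notin> T"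
    using P.normalizer_grows[OF p, of n T] ord less by (auto simp: order_def)
  have "g \<in> P" "g <#\<^bsub>G\<lparr>carrier := P\<rparr>\<^esub> T #>\<^bsub>G\<lparr>carrier := P\<rparr>\<^esub> (inv\<^bsub>G\<lparr>carrier := P\<rparr>\<^esub> g) = T"
    using g P.normalizer_mem_iff[of T g] less by auto
  then have "g <# T #> inv g = T" using P by (simp add: l_coset_def r_coset_def)
  then have "g \<in> normalizer G T" using normalizer_mem_iff[OF Ts] \<open>g \<in> P\<close> P by (auto dest: subgroup.mem_carrier)
  then show ?thesis using g \<open>g \<in> P\<close> by blast
qed

end

lemma p_core_trivialI:
  assumes "group G" and "\<And>N n. N \<lhd> G \<Longrightarrow> card N = p ^ n \<Longrightarrow> N = {\<one>\<^bsub>G\<^esub>}"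
  shows "p_core p G = {\<one>\<^bsub>G\<^esub>}"
  unfolding p_core_def
proof (rule Greatest_equality)
  show "{\<one>\<^bsub>G\<^esub>} \<lhd> G \<and> (\<exists>n. card {\<one>\<^bsub>G\<^esub>} = p ^ n)"
    using group.one_is_normal[OF assms(1)] by (auto intro: exI[of _ 0])
qed (use assms(2) in blast)

context group
begin

lemma conj_mult:
  assumes "g \<in> carrier G" "x \<in> carrier G" "y \<in> carrier G"
  shows "g \<otimes> (x \<otimes> y) \<otimes> inv g = (g \<otimes> x \<otimes> inv g) \<otimes> (g \<otimes> y \<otimes> inv g)"
proof -
  have "inv g \<otimes> (g \<otimes> z) = z" if "z \<in> carrier G" for z
    using assms(1) that by (simp add: m_assoc[symmetric])
  then show ?thesis using assms by (simp add: m_assoc)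
qed

lemma conj_comp:
  assumes "g \<in> carrier G" "h \<in> carrier G" "x \<in> carrier G"
  shows "g \<otimes> (h \<otimes> x \<otimes> inv h) \<otimes> inv g = (g \<otimes> h) \<otimes> x \<otimes> inv (g \<otimes> h)"
  using assms by (simp add: m_assoc inv_mult_group)

lemma sylow_subgroup_exists:
  assumes fin: "finite (carrier G)" and p: "Factorial_Ring.prime p"
  shows "\<exists>T. sylow_subgroup p G T"
proof -
  obtain m where "order G = p ^ multiplicity p (order G) * m"
    using multiplicity_dvd by (metis dvdE)
  then show ?thesis
    using sylow_thm[OF p is_group _ fin] by (auto simp: sylow_subgroup_def)
qed

text \<open>A greatest normal \<open>p\<close>-subgroup does exist: it is the intersection of the conjugates of a Sylow
  subgroup, because by Sylow conjugacy every normal \<open>p\<close>-subgroup lies in each of them.\<close>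

lemma normal_le_p_core:
  assumes fin: "finite (carrier G)" and p: "Factorial_Ring.prime p"
    and N: "N \<lhd> G" and cN: "card N = p ^ n"
  shows "N \<subseteq> p_core p G"
proof -
  obtain T where T: "sylow_subgroup p G T" using sylow_subgroup_exists[OF fin p] by blast
  have Tsub: "subgroup T G" using T by (simp add: sylow_subgroup_def)
  define Core where "Core = {x \<in> carrier G. \<forall>g \<in> carrier G. g \<otimes> x \<otimes> inv g \<in> T}"
  have up: "M \<subseteq> Core" if M: "M \<lhd> G" "card M = p ^ m" for M m
  proof
    fix x assume x: "x \<in> M"
    have "g \<otimes> x \<otimes> inv g \<in> T" if "g \<in> carrier G" for g
      using normal.inv_op_closed2[OF M(1) that x] normal_p_subgroup_le_sylow[OF fin p T M] by blast
    then show "x \<in> Core" using x M by (auto simp: Core_def dest: normal_imp_subgroup subgroup.mem_carrier)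
  qed
  have Osub: "subgroup Core G"
  proof (rule subgroupI)
    show "Core \<subseteq> carrier G" by (auto simp: Core_def)
    show "Core \<noteq> {}" using Tsub by (auto simp: Core_def subgroup.one_closed intro!: exI[of _ \<one>])
    fix x assume x: "x \<in> Core"
    then have xc: "x \<in> carrier G" by (simp add: Core_def)
    have "g \<otimes> inv x \<otimes> inv g \<in> T" if g: "g \<in> carrier G" for g
    proof -
      have "inv (g \<otimes> x \<otimes> inv g) \<in> T" using x g Tsub by (simp add: Core_def subgroup.m_inv_closed)
      then show ?thesis using g xc by (simp add: inv_mult_group m_assoc)
    qed
    then show "inv x \<in> Core" using xc by (simp add: Core_def)
    fix y assume y: "y \<in> Core"
    then have yc: "y \<in> carrier G" by (simp add: Core_def)
    have "g \<otimes> (x \<otimes> y) \<otimes> inv g \<in> T" if g: "g \<in> carrier G" for g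
    proof -
      have "(g \<otimes> x \<otimes> inv g) \<otimes> (g \<otimes> y \<otimes> inv g) \<in> T"
        using x y g Tsub by (simp add: Core_def subgroup.m_closed)
      moreover have "(g \<otimes> x \<otimes> inv g) \<otimes> (g \<otimes> y \<otimes> inv g) = g \<otimes> (x \<otimes> y) \<otimes> inv g"
        using g xc yc by (simp add: conj_mult)
      ultimately show ?thesis by simp
    qed
    then show "x \<otimes> y \<in> Core" using xc yc by (simp add: Core_def)
  qed
  have OT: "Core \<subseteq> T"
    by (auto simp: Core_def) (metis inv_one l_one one_closed r_one)
  have "Core \<lhd> G"
    unfolding normal_inv_iff
  proof (intro conjI ballI Osub)
    fix h x assume h: "h \<in> carrier G" and x: "x \<in> Core"
    then have xc: "x \<in> carrier G" by (simp add: Core_def)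
    have "g \<otimes> (h \<otimes> x \<otimes> inv h) \<otimes> inv g \<in> T" if g: "g \<in> carrier G" for g
    proof -
      have "g \<otimes> (h \<otimes> x \<otimes> inv h) \<otimes> inv g = (g \<otimes> h) \<otimes> x \<otimes> inv (g \<otimes> h)"
        using g h xc by (rule conj_comp)
      then show ?thesis using x g h by (simp add: Core_def)
    qed
    then show "h \<otimes> x \<otimes> inv h \<in> Core" using h xc by (simp add: Core_def)
  qed
  moreover have "\<exists>n. card Core = p ^ n"
    using subgroup_card_p_power[OF p Tsub Osub OT] T by (auto simp: sylow_subgroup_def)
  ultimately have "p_core p G = Core"
    unfolding p_core_def using up by (intro Greatest_equality) auto
  then show ?thesis using up[OF N cN] by simp
qed

lemma sylow_subgroup_within:
  assumes fin: "finite (carrier G)" and p: "Factorial_Ring.prime p"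
    and H: "subgroup H G" and T: "sylow_subgroup p G T" and le: "T \<subseteq> H"
  shows "sylow_subgroup p (G\<lparr>carrier := H\<rparr>) T"
proof -
  have Tsub: "subgroup T G" and cT: "card T = p ^ multiplicity p (order G)"
    using T by (auto simp: sylow_subgroup_def)
  have pos: "card H \<noteq> 0"
    using fin H by (metis card_0_eq empty_iff finite_subset subgroup.one_closed subgroup.subset)
  have "p ^ multiplicity p (order G) dvd card H"
    using card_subgroup_dvd[OF H Tsub le] cT by simp
  then have "multiplicity p (order G) \<le> multiplicity p (card H)"
    using p pos power_dvd_iff_le_multiplicity[of "card H" p] not_prime_unit by blast
  moreover have "multiplicity p (card H) \<le> multiplicity p (order G)"
    using card_subgroup_dvd[OF subgroup_self H subgroup.subset[OF H]] fin
    by (intro dvd_imp_multiplicity_le) (auto simp: order_def)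
  ultimately show ?thesis
    using H Tsub le cT by (simp add: sylow_subgroup_def order_def subgroup_incl)
qed

text \<open>Take \<open>L \<le> H\<close> of order \<open>p\<close> and let it act on the cosets of the strongly embedded subgroup \<open>H\<close>. A
  fixed coset \<open>H #> g\<close> puts a conjugate of \<open>L\<close> into \<open>H\<close>, which forces \<open>g \<in> H\<close>; so exactly one coset is
  fixed and the index of \<open>H\<close> is prime to \<open>p\<close>. A normal \<open>p\<close>-subgroup therefore also fixes a coset, which
  means that it lies in \<open>H\<close>. Being normal, it lies in every conjugate of \<open>H\<close> too, which is impossible
  unless it is trivial.\<close>

lemma strongly_p_embedded_normal_p_trivial:
  assumes fin: "finite (carrier G)" and p: "Factorial_Ring.prime p"
    and H: "strongly_p_embedded p G H" and N: "N \<lhd> G" and cN: "card N = p ^ n"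
  shows "N = {\<one>}"
proof (rule ccontr)
  assume nt: "N \<noteq> {\<one>}"
  have Hs: "subgroup H G" and Hne: "H \<noteq> carrier G" and pH: "p dvd card H"
    and int: "\<And>g. g \<in> carrier G - H \<Longrightarrow> \<not> p dvd card (H \<inter> (g <# H #> inv g))"
    using H by (auto simp: strongly_p_embedded_def)
  have Hc: "H \<subseteq> carrier G" using Hs by (rule subgroup.subset)
  have finH: "finite H" using Hc fin by (rule finite_subset)
  have Ns: "subgroup N G" using N by (rule normal_imp_subgroup)
  have conj_set: "g <# H #> inv g = (\<lambda>h. g \<otimes> h \<otimes> inv g) ` H" for g
    by (auto simp: l_coset_def r_coset_def)
  have conj_sub: "subgroup (g <# H #> inv g) G" if "g \<in> carrier G" for g
    using subgroup_conjugation_is_surj1[of "inv g" H] Hs that by simp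
  \<comment> \<open>Strong embedding, used contrapositively: conjugating a subgroup \<open>K \<le> H\<close> of order divisible by \<open>p\<close>
      back into \<open>H\<close> can only be done from inside \<open>H\<close>.\<close>
  have int': "g \<in> H" if g: "g \<in> carrier G" and K: "subgroup K G" "K \<subseteq> H" "p dvd card K"
    and Kg: "\<And>k. k \<in> K \<Longrightarrow> inv g \<otimes> k \<otimes> g \<in> H" for g K
  proof (rule ccontr)
    assume "g \<notin> H"
    then have no: "\<not> p dvd card (H \<inter> (g <# H #> inv g))" using int g by blast
    have "K \<subseteq> g <# H #> inv g"
    proof
      fix k assume k: "k \<in> K"
      have "k = g \<otimes> (inv g \<otimes> k \<otimes> g) \<otimes> inv g"
        using conjugation_is_surj[of g k] g k K Hc by auto
      then show "k \<in> g <# H #> inv g" using Kg[OF k] unfolding conj_set by blast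
    qed
    then have "card K dvd card (H \<inter> (g <# H #> inv g))"
      using K conj_sub[OF g] Hs by (intro card_subgroup_dvd subgroups_Inter_pair) auto
    then show False using no K(3) dvd_trans by blast
  qed
  obtain m where "card H = p * m" using pH by blast
  then obtain L where L0: "subgroup L (G\<lparr>carrier := H\<rparr>)" "card L = p ^ 1"
    using sylow_thm[OF p subgroup_imp_group[OF Hs], of 1 m] finH by (auto simp: order_def)
  have L: "subgroup L G" "L \<subseteq> H"
    using L0 Hs incl_subgroup subgroup.subset by fastforce+
  let ?X = "{C \<in> rcosets H. \<exists>g \<in> carrier G. C = H #> g \<and> (\<forall>k \<in> L. g \<otimes> k \<otimes> inv g \<in> H)}"
  have "?X \<subseteq> {H}"
  proof
    fix C assume "C \<in> ?X"
    then obtain g where g: "g \<in> carrier G" "C = H #> g" "\<forall>k \<in> L. g \<otimes> k \<otimes> inv g \<in> H" by blast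
    have "inv g \<in> H"
      using int'[of "inv g" L] g L L0 by simp
    then have "g \<in> H" using Hs g(1) by (metis inv_inv subgroup.m_inv_closed)
    then show "C \<in> {H}" using g Hs coset_join2 by simp
  qed
  moreover have "H \<in> ?X"
  proof -
    have "H = H #> \<one>" using Hc by simp
    moreover have "\<forall>k \<in> L. \<one> \<otimes> k \<otimes> inv \<one> \<in> H" using L Hc by (auto simp: subset_iff)
    moreover have "H \<in> rcosets H" using subgroup.subgroup_in_rcosets[OF Hs is_group] .
    ultimately show ?thesis by blast
  qed
  ultimately have X: "?X = {H}" by blast
  have "card (rcosets H) mod p = 1"
    using index_mod_fixed_cosets[OF fin p Hs L(1) L0(2)] X prime_gt_1_nat[OF p] by simp
  then have "card {C \<in> rcosets H. \<exists>g \<in> carrier G. C = H #> g \<and> (\<forall>k \<in> N. g \<otimes> k \<otimes> inv g \<in> H)} \<noteq> 0"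
    using index_mod_fixed_cosets[OF fin p Hs Ns cN] by (intro notI) simp
  then have "{C \<in> rcosets H. \<exists>g \<in> carrier G. C = H #> g \<and> (\<forall>k \<in> N. g \<otimes> k \<otimes> inv g \<in> H)} \<noteq> {}"
    by (metis card.empty)
  then obtain g where g: "g \<in> carrier G" "\<forall>k \<in> N. g \<otimes> k \<otimes> inv g \<in> H" by blast
  have NH: "N \<subseteq> H"
  proof
    fix x assume x: "x \<in> N"
    have xc: "x \<in> carrier G" using x Ns by (rule subgroup.mem_carrier[rotated])
    have "inv g \<otimes> x \<otimes> g \<in> N" using normal.inv_op_closed1[OF N g(1) x] .
    then have "g \<otimes> (inv g \<otimes> x \<otimes> g) \<otimes> inv g \<in> H" using g by blast
    then show "x \<in> H" using g(1) xc by (metis inv_closed inv_solve_left m_assoc m_closed r_inv r_one)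
  qed
  have "n \<noteq> 0"
  proof
    assume "n = 0"
    then obtain y where "N = {y}" using cN card_1_singletonE by auto
    then show False using nt subgroup.one_closed[OF Ns] by blast
  qed
  then have "p dvd card N" using cN by simp
  then have "g \<in> H" if "g \<in> carrier G" for g
    using int'[OF that Ns NH] normal.inv_op_closed1[OF N that] NH by blast
  then show False using Hne Hc by blast
qed

end

section \<open>Strongly embedded subgroups of quotients\<close>

context group
begin

lemma conj_image_subgroup:
  assumes g: "g \<in> carrier G" and K: "subgroup K G"
  shows "subgroup ((\<lambda>k. g \<otimes> k \<otimes> inv g) ` K) G" "card ((\<lambda>k. g \<otimes> k \<otimes> inv g) ` K) = card K"
proof -
  have "g <# K #> inv g = (\<lambda>k. g \<otimes> k \<otimes> inv g) ` K" by (auto simp: l_coset_def r_coset_def)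
  then show "subgroup ((\<lambda>k. g \<otimes> k \<otimes> inv g) ` K) G"
    using subgroup_conjugation_is_surj1[of "inv g" K] K g by simp
  show "card ((\<lambda>k. g \<otimes> k \<otimes> inv g) ` K) = card K"
    using g subgroup.subset[OF K] by (intro card_image inj_onI) (meson conjugation_is_inj subsetD)
qed

lemma p_subgroup_conjugate_into_sylow_within:
  assumes fin: "finite (carrier G)" and p: "Factorial_Ring.prime p"
    and H: "subgroup H G" and T: "sylow_subgroup p G T" and le: "T \<subseteq> H"
    and K: "subgroup K G" "K \<subseteq> H" and cK: "card K = p ^ n"
  shows "\<exists>h \<in> H. \<forall>k \<in> K. h \<otimes> k \<otimes> inv h \<in> T"
proof -
  have "\<exists>h \<in> H. \<forall>k \<in> K. h \<otimes> k \<otimes> inv\<^bsub>G\<lparr>carrier := H\<rparr>\<^esub> h \<in> T"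
    using group.p_subgroup_conjugate_into_sylow[OF subgroup_imp_group[OF H] _ p
        sylow_subgroup_within[OF fin p H T le] subgroup_incl[OF K(1) H K(2)] cK]
      finite_subset[OF subgroup.subset[OF H] fin] by simp
  then show ?thesis using H by (metis m_inv_consistent)
qed

text \<open>The form in which strongly embedded subgroups of outer automorphism groups are recognised, with
  \<open>G\<close>, \<open>I\<close> and \<open>T\<close> in the roles of $\mathrm{Aut}_{\mathcal{F}}(R)$, $\mathrm{Inn}(R)$ and
  $\mathrm{Aut}_S(R)$. If \<open>p\<close> divides the order of an intersection of the image of \<open>H\<close> with its conjugate
  by \<open>I #> g\<close>, lift a subgroup of order \<open>p\<close> to a \<open>p\<close>-group \<open>K\<close> with $I < K \le H \cap gHg^{-1}$. Sylow
  conjugacy in \<open>H\<close> moves both \<open>K\<close> and $g^{-1}Kg$ into \<open>T\<close> by elements of \<open>H\<close>. The product of these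
  elements with $g^{-1}$ then maps an element of \<open>T - I\<close> into \<open>T\<close>, so it lies in \<open>H\<close> by the control
  hypothesis, and hence so does \<open>g\<close>.\<close>

lemma strongly_p_embedded_ModI:
  assumes fin: "finite (carrier G)" and p: "Factorial_Ring.prime p"
    and I: "I \<lhd> G" and cI: "card I = p ^ i"
    and H: "subgroup H G" and Hne: "H \<noteq> carrier G"
    and T: "sylow_subgroup p G T" and TH: "T \<subseteq> H" and IT: "I \<subset> T"
    and control: "\<And>k g. \<lbrakk>k \<in> T - I; g \<in> carrier G; g \<otimes> k \<otimes> inv g \<in> T\<rbrakk> \<Longrightarrow> g \<in> H"
  shows "strongly_p_embedded p (G Mod I) ((\<lambda>a. I #> a) ` H)"
proof -
  interpret I: normal I G by (rule I)
  interpret Q: group "G Mod I" by (rule I.factorgroup_is_group)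
  interpret pi: group_hom G "G Mod I" "\<lambda>a. I #> a"
    by (intro group_hom.intro group_hom_axioms.intro is_group Q.is_group I.r_coset_hom_Mod)
  let ?H = "(\<lambda>a. I #> a) ` H"
  have Hc: "H \<subseteq> carrier G" using H by (rule subgroup.subset)
  have Tsub: "subgroup T G" and cT: "card T = p ^ multiplicity p (order G)"
    using T by (auto simp: sylow_subgroup_def)
  have Qc: "carrier (G Mod I) = (\<lambda>a. I #> a) ` carrier G"
    by (auto simp: FactGroup_def RCOSETS_def)
  have finQ: "finite (carrier (G Mod I))" using fin Qc by simp
  have ker: "b \<in> H" if "I #> a = I #> b" "a \<in> H" "b \<in> carrier G" for a b
  proof -
    have "b \<in> I #> a" using that rcos_self[OF _ I.is_subgroup] by simp
    then obtain c where "c \<in> I" "b = c \<otimes> a" by (auto simp: r_coset_def)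
    then show ?thesis using that IT TH H by (auto intro: subgroup.m_closed)
  qed
  have Hsub: "subgroup ?H (G Mod I)" using H by (rule pi.subgroup_img_is_subgroup)
  have QHne: "?H \<noteq> carrier (G Mod I)"
  proof
    assume eq: "?H = carrier (G Mod I)"
    have "g \<in> H" if g: "g \<in> carrier G" for g
    proof -
      have "I #> g \<in> ?H" using eq Qc g by blast
      then show ?thesis using ker[OF _ _ g] by auto
    qed
    then show False using Hne Hc by blast
  qed
  have pH: "p dvd card ?H"
  proof -
    note Timg = p_subgroup_hom_image[OF I.r_coset_hom_Mod Q.is_group Tsub p cT]
    then obtain m where m: "card ((\<lambda>a. I #> a) ` T) = p ^ m" by blast
    have "m \<noteq> 0"
    proof
      assume "m = 0"
      then obtain y where y: "(\<lambda>a. I #> a) ` T = {y}" using m card_1_singletonE by auto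
      obtain t where t: "t \<in> T" "t \<notin> I" using IT by blast
      have "I #> t = y" "I #> \<one> = y" using y t(1) subgroup.one_closed[OF Tsub] by blast+
      then have "I #> t = I" using coset_mult_one[OF I.subset] by metis
      then show False using t(2) rcos_self[OF subgroup.mem_carrier[OF Tsub t(1)] I.is_subgroup] by simp
    qed
    then have "p dvd card ((\<lambda>a. I #> a) ` T)" using m by simp
    moreover have "card ((\<lambda>a. I #> a) ` T) dvd card ?H"
      by (rule Q.card_subgroup_dvd[OF Hsub Timg(1)]) (use TH in blast)
    ultimately show ?thesis by (rule dvd_trans)
  qed
  have "\<not> p dvd card (?H \<inter> (Y <#\<^bsub>G Mod I\<^esub> ?H #>\<^bsub>G Mod I\<^esub> inv\<^bsub>G Mod I\<^esub> Y))"
    if Y: "Y \<in> carrier (G Mod I) - ?H" for Y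
  proof
    let ?J = "?H \<inter> (Y <#\<^bsub>G Mod I\<^esub> ?H #>\<^bsub>G Mod I\<^esub> inv\<^bsub>G Mod I\<^esub> Y)"
    assume dvd: "p dvd card ?J"
    obtain g where g: "g \<in> carrier G" "Y = I #> g" using Y Qc by auto
    have gH: "g \<notin> H" using Y g by auto
    have J: "subgroup ?J (G Mod I)"
      using Q.subgroup_conjugation_is_surj1[of "inv\<^bsub>G Mod I\<^esub> Y" ?H] Y Hsub
      by (intro Q.subgroups_Inter_pair) auto
    obtain m where "card ?J = p * m" using dvd by blast
    moreover have "finite ?J" using fin Hc by (meson finite_Int finite_imageI finite_subset)
    ultimately obtain L where L0: "subgroup L ((G Mod I)\<lparr>carrier := ?J\<rparr>)" "card L = p ^ 1"
      using sylow_thm[OF p Q.subgroup_imp_group[OF J], of 1 m] by (auto simp: order_def)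
    have L: "subgroup L (G Mod I)" "L \<subseteq> ?J"
      using L0 J Q.incl_subgroup subgroup.subset by fastforce+
    \<comment> \<open>the preimage of \<open>L\<close>, a \<open>p\<close>-group of order \<open>p * card I\<close>\<close>
    define K where "K = {a \<in> carrier G. I #> a \<in> L}"
    have K: "subgroup K G"
    proof (rule subgroupI)
      show "K \<subseteq> carrier G" by (auto simp: K_def)
      show "K \<noteq> {}" using subgroup.one_closed[OF L(1)] by (auto simp: K_def intro!: exI[of _ \<one>])
      fix a assume a: "a \<in> K"
      then show "inv a \<in> K" using subgroup.m_inv_closed[OF L(1), of "I #> a"] by (simp add: K_def)
      fix b assume b: "b \<in> K"
      show "a \<otimes> b \<in> K" using a b subgroup.m_closed[OF L(1), of "I #> a" "I #> b"] by (simp add: K_def)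
    qed
    have IK: "I \<subseteq> K"
    proof
      fix a assume a: "a \<in> I"
      then have "I #> a = \<one>\<^bsub>G Mod I\<^esub>" using coset_join2 I.is_subgroup by (simp add: FactGroup_def I.mem_carrier)
      then show "a \<in> K" using a subgroup.one_closed[OF L(1)] by (simp add: K_def I.mem_carrier)
    qed
    have KH: "K \<subseteq> H"
    proof
      fix a assume a: "a \<in> K"
      then have "I #> a \<in> ?H" using L by (auto simp: K_def)
      then show "a \<in> H" using a ker by (auto simp: K_def)
    qed
    have Kg: "inv g \<otimes> k \<otimes> g \<in> H" if k: "k \<in> K" for k
    proof -
      have kc: "k \<in> carrier G" using k by (simp add: K_def)
      have "I #> k \<in> Y <#\<^bsub>G Mod I\<^esub> ?H #>\<^bsub>G Mod I\<^esub> inv\<^bsub>G Mod I\<^esub> Y" using k L by (auto simp: K_def)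
      then obtain h where h: "h \<in> H"
        "I #> k = Y \<otimes>\<^bsub>G Mod I\<^esub> (I #> h) \<otimes>\<^bsub>G Mod I\<^esub> inv\<^bsub>G Mod I\<^esub> Y"
        by (auto simp: l_coset_def r_coset_def)
      have hc: "h \<in> carrier G" using h Hc by blast
      have "I #> (inv g \<otimes> k \<otimes> g) = inv\<^bsub>G Mod I\<^esub> Y \<otimes>\<^bsub>G Mod I\<^esub> (I #> k) \<otimes>\<^bsub>G Mod I\<^esub> Y"
        using g kc by simp
      also have "\<dots> = I #> h"
        unfolding h(2) using g hc
          Q.conjugation_is_surj[of "inv\<^bsub>G Mod I\<^esub> Y" "I #> h"] Y by simp
      finally have "I #> h = I #> (inv g \<otimes> k \<otimes> g)" by simp
      then show ?thesis by (rule ker) (use h g kc in auto)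
    qed
    have "K = \<Union>L"
    proof
      show "K \<subseteq> \<Union>L" using rcos_self[OF _ I.is_subgroup] by (auto simp: K_def)
      show "\<Union>L \<subseteq> K"
      proof
        fix a assume "a \<in> \<Union>L"
        then obtain C where C: "C \<in> L" "a \<in> C" by blast
        then obtain b where b: "b \<in> carrier G" "C = I #> b" using subgroup.mem_carrier[OF L(1)] Qc by blast
        have ac: "a \<in> carrier G" using C b I.subset by (auto simp: r_coset_def)
        have "I #> a = C" using repr_independence[OF _ b(1) I.is_subgroup] C b by simp
        then show "a \<in> K" using C ac by (simp add: K_def)
      qed
    qed
    moreover have "card I * card L = card (\<Union>L)"
    proof (rule card_partition)
      have LR: "L \<subseteq> rcosets I" using subgroup.subset[OF L(1)] by (simp add: FactGroup_def)
      show "finite L" using finQ subgroup.subset[OF L(1)] by (rule finite_subset[rotated])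
      show "finite (\<Union>L)" using fin unfolding \<open>K = \<Union>L\<close>[symmetric] by (simp add: K_def)
      show "card c = card I" if "c \<in> L" for c
        using card_rcosets_equal[OF _ I.subset] that LR by auto
      show "c1 \<inter> c2 = {}" if "c1 \<in> L" "c2 \<in> L" "c1 \<noteq> c2" for c1 c2
        using rcos_disjoint[OF I.is_subgroup] that LR by (auto simp: pairwise_def disjnt_def)
    qed
    ultimately have cK: "card K = p ^ Suc i" using cI L0(2) by (simp add: mult.commute)
    have "K \<noteq> I" using cK cI prime_gt_1_nat[OF p] by auto
    then obtain x where x: "x \<in> K" "x \<notin> I" using IK by blast
    have xc: "x \<in> carrier G" using x by (simp add: K_def)
    obtain h1 where h1: "h1 \<in> H" "\<forall>k \<in> K. h1 \<otimes> k \<otimes> inv h1 \<in> T"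
      using p_subgroup_conjugate_into_sylow_within[OF fin p H T TH K KH cK] by blast
    let ?K = "(\<lambda>k. inv g \<otimes> k \<otimes> inv (inv g)) ` K"
    have K': "subgroup ?K G" "card ?K = p ^ Suc i"
      using conj_image_subgroup[of "inv g" K] g K cK by auto
    have "?K \<subseteq> H" using Kg g by auto
    then obtain h2 where h2: "h2 \<in> H" "\<forall>k \<in> ?K. h2 \<otimes> k \<otimes> inv h2 \<in> T"
      using p_subgroup_conjugate_into_sylow_within[OF fin p H T TH K'(1) _ K'(2)] by blast
    have hc: "h1 \<in> carrier G" "h2 \<in> carrier G" using h1 h2 Hc by auto
    define k where "k = h1 \<otimes> x \<otimes> inv h1"
    define u where "u = h2 \<otimes> inv g \<otimes> inv h1"
    have kT: "k \<in> T" using h1 x by (simp add: k_def)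
    have kI: "k \<notin> I"
    proof
      assume "k \<in> I"
      then have "inv h1 \<otimes> k \<otimes> h1 \<in> I" using I.inv_op_closed1 hc by blast
      then show False using x hc xc conjugation_is_surj[of "inv h1" x] by (simp add: k_def)
    qed
    have uc: "u \<in> carrier G" using hc g by (simp add: u_def)
    have "u \<otimes> k \<otimes> inv u = h2 \<otimes> (inv g \<otimes> (inv h1 \<otimes> k \<otimes> inv (inv h1)) \<otimes> inv (inv g)) \<otimes> inv h2"
      unfolding u_def using hc g xc by (subst conj_comp | simp add: k_def m_assoc inv_mult_group)+
    also have "inv h1 \<otimes> k \<otimes> inv (inv h1) = x"
      using conjugation_is_surj[of "inv h1" x] hc xc by (simp add: k_def)
    also have "h2 \<otimes> (inv g \<otimes> x \<otimes> inv (inv g)) \<otimes> inv h2 \<in> T" using h2 x by blast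
    finally have "u \<in> H" using control kT kI uc by blast
    then have "inv h2 \<otimes> u \<otimes> h1 \<in> H" using h1 h2 H by (simp add: subgroup.m_closed subgroup.m_inv_closed)
    moreover have "inv h2 \<otimes> u \<otimes> h1 = inv g"
    proof -
      have "inv h2 \<otimes> (h2 \<otimes> inv g) = inv g" using hc g by (simp add: m_assoc[symmetric])
      then show ?thesis using hc g by (simp add: u_def m_assoc)
    qed
    ultimately have "g \<in> H" using H g by (metis inv_inv subgroup.m_inv_closed)
    then show False using gH by blast
  qed
  then show ?thesis unfolding strongly_p_embedded_def using Hsub QHne pH by blast
qed

end

section \<open>Morphisms and automorphism groups of fusion systems\<close>

context fusion_system
begin

lemma hom_inj: "\<phi> \<in> F P Q \<Longrightarrow> inj_on \<phi> P"
  using inj_hom by (fastforce simp: mon_def)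

lemma hom_source: "\<phi> \<in> F P Q \<Longrightarrow> subgroup P S"
  and hom_target: "\<phi> \<in> F P Q \<Longrightarrow> subgroup Q S"
  using objects by blast+

lemma hom_closed: "\<phi> \<in> F P Q \<Longrightarrow> x \<in> P \<Longrightarrow> \<phi> x \<in> Q"
  using hom_img by blast

lemma hom_carrier: "\<phi> \<in> F P Q \<Longrightarrow> x \<in> P \<Longrightarrow> \<phi> x \<in> carrier S"
  using hom_closed hom_target subgroup.mem_carrier by metis

lemma finite_subgroup: "subgroup P S \<Longrightarrow> finite P"
  using finite_S subgroup.subset finite_subset by metis

lemma conj_hom:
  assumes P: "subgroup P S" and Q: "subgroup Q S" and g: "g \<in> carrier S"
    and img: "\<And>x. x \<in> P \<Longrightarrow> g \<otimes> x \<otimes> inv g \<in> Q"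
  shows "conj_map S P g \<in> F P Q"
proof -
  have "conj_map S P g \<in> conj_homs S (carrier S) P Q"
    using g img by (auto simp: conj_homs_def conj_map_def)
  then show ?thesis using conj_in[OF P Q] by blast
qed

lemma inclusion_hom:
  assumes P: "subgroup P S" and Q: "subgroup Q S" and le: "P \<subseteq> Q"
  shows "(\<lambda>x\<in>P. x) \<in> F P Q"
proof -
  have "conj_map S P \<one> = (\<lambda>x\<in>P. x)"
    using P by (auto simp: conj_map_def fun_eq_iff dest: subgroup.mem_carrier)
  moreover have "conj_map S P \<one> \<in> F P Q"
    using P Q le by (intro conj_hom) (auto simp: subgroup.mem_carrier[OF P])
  ultimately show ?thesis by simp
qed

lemma hom_onto_image: "\<phi> \<in> F P Q \<Longrightarrow> \<phi> \<in> F P (\<phi> ` P)"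
  using iso_onto_image by (auto simp: fs_isos_def)

lemma hom_image_subgroup: "\<phi> \<in> F P Q \<Longrightarrow> subgroup (\<phi> ` P) S"
  using hom_onto_image hom_target by blast

lemma hom_codomain:
  assumes h: "\<phi> \<in> F P Q" and R: "subgroup R S" and le: "\<phi> ` P \<subseteq> R"
  shows "\<phi> \<in> F P R"
proof -
  have "compose P (\<lambda>x\<in>\<phi> ` P. x) \<phi> \<in> F P R"
    by (rule comp[OF hom_onto_image[OF h] inclusion_hom[OF hom_image_subgroup[OF h] R le]])
  moreover have "compose P (\<lambda>x\<in>\<phi> ` P. x) \<phi> = \<phi>"
    using hom_ext[OF h] by (auto simp: compose_def fun_eq_iff extensional_def)
  ultimately show ?thesis by simp
qed

lemma hom_into_S: "\<phi> \<in> F P Q \<Longrightarrow> \<phi> \<in> F P (carrier S)"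
  using hom_codomain[OF _ subgroup_self] hom_carrier by (meson image_subsetI)

lemma hom_restrict:
  assumes h: "\<phi> \<in> F P Q" and R: "subgroup R S" and le: "R \<subseteq> P"
  shows "restrict \<phi> R \<in> F R Q"
proof -
  have "compose R \<phi> (\<lambda>x\<in>R. x) \<in> F R Q"
    by (rule comp[OF inclusion_hom[OF R hom_source[OF h] le] h])
  moreover have "compose R \<phi> (\<lambda>x\<in>R. x) = restrict \<phi> R"
    by (auto simp: compose_def fun_eq_iff)
  ultimately show ?thesis by simp
qed

lemma hom_inverse: "\<phi> \<in> F P Q \<Longrightarrow> restrict (inv_into P \<phi>) (\<phi> ` P) \<in> F (\<phi> ` P) P"
  using iso_onto_image by (auto simp: fs_isos_def)

lemma hom_conj:
  assumes h: "\<phi> \<in> F P Q" and x: "g \<in> P" "x \<in> P"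
  shows "\<phi> (g \<otimes> x \<otimes> inv g) = \<phi> g \<otimes> \<phi> x \<otimes> inv (\<phi> g)"
proof -
  note P = hom_source[OF h]
  have gx: "g \<otimes> x \<in> P" "inv g \<in> P" using P x by (auto simp: subgroup.m_closed subgroup.m_inv_closed)
  have one: "\<one> \<in> P" using P by (rule subgroup.one_closed)
  have "\<phi> \<one> \<otimes> \<phi> \<one> = \<phi> \<one>" using hom_mult[OF h one one] by simp
  then have "\<phi> \<one> = \<one>" using hom_carrier[OF h one] by simp
  moreover have "\<phi> (inv g \<otimes> g) = \<phi> (inv g) \<otimes> \<phi> g" using hom_mult[OF h gx(2) x(1)] .
  ultimately have "\<phi> (inv g) = inv (\<phi> g)"
    using inv_equality[of "\<phi> (inv g)" "\<phi> g"] hom_carrier[OF h] x gx P by (simp add: subgroup.mem_carrier)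
  then show ?thesis using hom_mult[OF h gx] hom_mult[OF h x] by simp
qed

lemma aut_image: "\<alpha> \<in> F P P \<Longrightarrow> \<alpha> ` P = P"
  using endo_inj_surj[OF finite_subgroup] hom_source hom_img hom_inj by metis

text \<open>It is convenient to see every morphism as one into \<open>S\<close>; the subgroups $\mathcal{F}$-isomorphic to \<open>P\<close>
  are then the images of such morphisms.\<close>

lemma fs_isomorphic_iff: "fs_isomorphic F P R \<longleftrightarrow> (\<exists>\<phi> \<in> F P (carrier S). \<phi> ` P = R)"
proof
  assume "fs_isomorphic F P R"
  then obtain \<phi> where "\<phi> \<in> F P R" "bij_betw \<phi> P R" by (auto simp: fs_isomorphic_def fs_isos_def)
  then show "\<exists>\<phi> \<in> F P (carrier S). \<phi> ` P = R" using hom_into_S by (auto simp: bij_betw_def)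
next
  assume "\<exists>\<phi> \<in> F P (carrier S). \<phi> ` P = R"
  then show "fs_isomorphic F P R" using iso_onto_image by (auto simp: fs_isomorphic_def)
qed

lemma fs_isomorphic_trans:
  assumes "fs_isomorphic F P Q" "fs_isomorphic F Q R"
  shows "fs_isomorphic F P R"
proof -
  obtain \<phi> \<psi> where h: "\<phi> \<in> F P (carrier S)" "\<phi> ` P = Q" "\<psi> \<in> F Q (carrier S)" "\<psi> ` Q = R"
    using assms by (auto simp: fs_isomorphic_iff)
  then have "compose P \<psi> \<phi> \<in> F P (carrier S)" using hom_onto_image[OF h(1)] by (intro comp) auto
  moreover have "compose P \<psi> \<phi> ` P = R" using h by (auto simp: compose_def)
  ultimately show ?thesis by (auto simp: fs_isomorphic_iff)
qed

lemma normalizer_finite_iff: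
  assumes P: "subgroup P S"
  shows "g \<in> normalizer S P \<longleftrightarrow> g \<in> carrier S \<and> (\<forall>x \<in> P. g \<otimes> x \<otimes> inv g \<in> P)"
proof -
  have eq: "g <# P #> inv g = (\<lambda>x. g \<otimes> x \<otimes> inv g) ` P" by (auto simp: l_coset_def r_coset_def)
  have "(\<lambda>x. g \<otimes> x \<otimes> inv g) ` P = P" if "g \<in> carrier S" "\<forall>x \<in> P. g \<otimes> x \<otimes> inv g \<in> P"
  proof (rule endo_inj_surj[OF finite_subgroup[OF P]])
    show "(\<lambda>x. g \<otimes> x \<otimes> inv g) ` P \<subseteq> P" using that by blast
    show "inj_on (\<lambda>x. g \<otimes> x \<otimes> inv g) P"
      using that(1) subgroup.subset[OF P] by (intro inj_onI) (meson conjugation_is_inj subsetD)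
  qed
  then show ?thesis unfolding normalizer_mem_iff[OF subgroup.subset[OF P]] eq by auto
qed

lemma normalizer_subgroup: "subgroup P S \<Longrightarrow> subgroup (normalizer S P) S"
  using normalizer_imp_subgroup subgroup.subset by blast

lemma le_normalizer: "subgroup P S \<Longrightarrow> P \<subseteq> normalizer S P"
  by (auto simp: normalizer_finite_iff subgroup.mem_carrier subgroup.m_closed subgroup.m_inv_closed)

lemma normalizer_S: "normalizer S (carrier S) = carrier S"
  using le_normalizer[OF subgroup_self] by (auto simp: normalizer_def stabilizer_def)

lemma subgroup_p_card: "subgroup P S \<Longrightarrow> \<exists>n. card P = p ^ n"
  using subgroup_card_p_power[OF prime_p subgroup_self] order_p_power subgroup.subset
  by (metis order_def)

lemma conj_homs_iff:
  "\<gamma> \<in> conj_homs S H P P \<longleftrightarrow> (\<exists>g \<in> H. \<gamma> = conj_map S P g \<and> (\<forall>x \<in> P. g \<otimes> x \<otimes> inv g \<in> P))"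
proof -
  have "conj_map S P g ` P \<subseteq> P \<longleftrightarrow> (\<forall>x \<in> P. g \<otimes> x \<otimes> inv g \<in> P)" for g
    by (auto simp: conj_map_def)
  then show ?thesis by (auto simp: conj_homs_def)
qed

lemma aut_S_eq:
  assumes P: "subgroup P S"
  shows "conj_homs S (carrier S) P P = conj_map S P ` normalizer S P"
  unfolding set_eq_iff conj_homs_iff image_iff by (auto simp only: normalizer_finite_iff[OF P])

lemma inn_eq: "subgroup P S \<Longrightarrow> conj_homs S P P P = conj_map S P ` P"
  by (auto simp: conj_homs_def conj_map_def subgroup.m_closed subgroup.m_inv_closed)

lemma conj_map_aut:
  assumes "subgroup P S" "g \<in> normalizer S P"
  shows "conj_map S P g \<in> F P P"
  using assms by (intro conj_hom) (auto simp: normalizer_finite_iff)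

lemma conj_map_eq_iff:
  assumes "g \<in> carrier S" "h \<in> carrier S"
  shows "conj_map S P g = conj_map S P h \<longleftrightarrow> (\<forall>x \<in> P. g \<otimes> x \<otimes> inv g = h \<otimes> x \<otimes> inv h)"
  by (simp add: conj_map_def fun_eq_iff) (metis restrict_apply)

lemma aut_Bij: "F P P \<subseteq> Bij P"
  using aut_image hom_ext hom_inj by (auto simp: Bij_def bij_betw_def)

lemma carrier_aut_group [simp]: "carrier (aut_group F P) = F P P"
  by (simp add: aut_group_def)

lemma mult_aut_group: "\<alpha> \<in> F P P \<Longrightarrow> \<beta> \<in> F P P \<Longrightarrow> \<alpha> \<otimes>\<^bsub>aut_group F P\<^esub> \<beta> = compose P \<alpha> \<beta>"
  using aut_Bij by (auto simp: aut_group_def BijGroup_def)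

lemma one_aut_group: "\<one>\<^bsub>aut_group F P\<^esub> = (\<lambda>x\<in>P. x)"
  by (simp add: aut_group_def BijGroup_def)

lemma aut_group_is_group:
  assumes P: "subgroup P S"
  shows "group (aut_group F P)"
proof -
  have "subgroup (F P P) (BijGroup P)"
  proof (rule group.subgroupI[OF group_BijGroup])
    show "F P P \<subseteq> carrier (BijGroup P)" using aut_Bij by (auto simp: BijGroup_def)
    show "F P P \<noteq> {}" using inclusion_hom[OF P P] by blast
    fix \<alpha> assume a: "\<alpha> \<in> F P P"
    show "inv\<^bsub>BijGroup P\<^esub> \<alpha> \<in> F P P"
      using hom_inverse[OF a] aut_image[OF a] inv_BijGroup[OF subsetD[OF aut_Bij a]] by simp
    fix \<beta> assume b: "\<beta> \<in> F P P"
    show "\<alpha> \<otimes>\<^bsub>BijGroup P\<^esub> \<beta> \<in> F P P"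
      using comp[OF b a] aut_Bij a b by (auto simp: BijGroup_def)
  qed
  then show ?thesis unfolding aut_group_def using group.subgroup_imp_group[OF group_BijGroup] by blast
qed

lemma finite_aut: "finite (F P P)"
proof -
  show ?thesis
  proof (cases "F P P = {}")
    case False
    then have "finite P" using hom_source finite_subgroup by blast
    then have "finite (P \<rightarrow>\<^sub>E P)" by (intro finite_PiE) auto
    moreover have "F P P \<subseteq> P \<rightarrow>\<^sub>E P" using hom_closed hom_ext by (auto simp: PiE_def)
    ultimately show ?thesis by (rule finite_subset[rotated])
  qed simp
qed

text \<open>Conjugation equations in $\mathrm{Aut}_{\mathcal{F}}(P)$ are only ever tested elementwise, which avoids
  computing with inverse maps.\<close>

lemma aut_conj_eq_iff:
  assumes a: "\<alpha> \<in> F P P" and b: "\<beta> \<in> F P P" and c: "\<gamma> \<in> F P P"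
  shows "\<alpha> \<otimes>\<^bsub>aut_group F P\<^esub> \<beta> \<otimes>\<^bsub>aut_group F P\<^esub> inv\<^bsub>aut_group F P\<^esub> \<alpha> = \<gamma> \<longleftrightarrow>
    (\<forall>x \<in> P. \<alpha> (\<beta> x) = \<gamma> (\<alpha> x))"
proof -
  interpret A: group "aut_group F P" using aut_group_is_group[OF hom_source[OF a]] .
  have "\<alpha> \<otimes>\<^bsub>aut_group F P\<^esub> \<beta> \<otimes>\<^bsub>aut_group F P\<^esub> inv\<^bsub>aut_group F P\<^esub> \<alpha> = \<gamma> \<longleftrightarrow>
      \<alpha> \<otimes>\<^bsub>aut_group F P\<^esub> \<beta> = \<gamma> \<otimes>\<^bsub>aut_group F P\<^esub> \<alpha>"
    using a b c A.inv_solve_right'[of \<gamma> "\<alpha> \<otimes>\<^bsub>aut_group F P\<^esub> \<beta>" \<alpha>] by (metis A.inv_solve_right' A.m_closed carrier_aut_group)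
  also have "\<dots> \<longleftrightarrow> compose P \<alpha> \<beta> = compose P \<gamma> \<alpha>"
    using a b c by (simp add: mult_aut_group)
  also have "\<dots> \<longleftrightarrow> (\<forall>x \<in> P. \<alpha> (\<beta> x) = \<gamma> (\<alpha> x))"
    by (simp add: compose_def fun_eq_iff) (metis restrict_apply)
  finally show ?thesis .
qed

lemma conj_map_hom:
  assumes P: "subgroup P S"
  shows "conj_map S P \<in> hom (S\<lparr>carrier := normalizer S P\<rparr>) (aut_group F P)"
proof (rule homI)
  fix g assume "g \<in> carrier (S\<lparr>carrier := normalizer S P\<rparr>)"
  then show "conj_map S P g \<in> carrier (aut_group F P)" using conj_map_aut[OF P] by simp
next
  fix g h assume "g \<in> carrier (S\<lparr>carrier := normalizer S P\<rparr>)" "h \<in> carrier (S\<lparr>carrier := normalizer S P\<rparr>)"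
  then have gh: "g \<in> normalizer S P" "h \<in> normalizer S P" by auto
  have "conj_map S P (g \<otimes> h) = compose P (conj_map S P g) (conj_map S P h)"
    using gh P by (auto simp: conj_map_def compose_def fun_eq_iff conj_comp normalizer_finite_iff
        dest: subgroup.mem_carrier)
  then show "conj_map S P (g \<otimes>\<^bsub>S\<lparr>carrier := normalizer S P\<rparr>\<^esub> h) =
      conj_map S P g \<otimes>\<^bsub>aut_group F P\<^esub> conj_map S P h"
    using gh conj_map_aut[OF P] by (simp add: mult_aut_group)
qed

lemma conj_map_image:
  assumes P: "subgroup P S" and D: "subgroup D S" "D \<subseteq> normalizer S P"
  shows "subgroup (conj_map S P ` D) (aut_group F P)" "\<exists>n. card (conj_map S P ` D) = p ^ n"
proof -
  obtain n where n: "card D = p ^ n" using subgroup_p_card[OF D(1)] by blast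
  have "subgroup D (S\<lparr>carrier := normalizer S P\<rparr>)"
    using D normalizer_subgroup[OF P] by (intro subgroup_incl)
  from group.p_subgroup_hom_image[OF subgroup_imp_group[OF normalizer_subgroup[OF P]] conj_map_hom[OF P]
      aut_group_is_group[OF P] this prime_p n]
  show "subgroup (conj_map S P ` D) (aut_group F P)" "\<exists>n. card (conj_map S P ` D) = p ^ n" by auto
qed

text \<open>The condition $\varphi c_g \varphi^{-1} = c_h$ that defines $N_\varphi$, evaluated at $\varphi(x)$.\<close>

lemma extension_domain_iff:
  assumes h: "\<phi> \<in> F P Q"
  shows "g \<in> extension_domain S P \<phi> \<longleftrightarrow> g \<in> normalizer S P \<and>
    (\<exists>h \<in> carrier S. \<forall>x \<in> P. \<phi> (g \<otimes> x \<otimes> inv g) = h \<otimes> \<phi> x \<otimes> inv h)"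
proof (cases "g \<in> normalizer S P")
  case True
  note P = hom_source[OF h] and inj = hom_inj[OF h]
  have gP: "g \<otimes> x \<otimes> inv g \<in> P" if "x \<in> P" for x using True P that by (simp add: normalizer_finite_iff)
  let ?\<gamma> = "compose (\<phi> ` P) \<phi> (compose (\<phi> ` P) (conj_map S P g) (inv_into P \<phi>))"
  have val: "?\<gamma> (\<phi> x) = \<phi> (g \<otimes> x \<otimes> inv g)" if "x \<in> P" for x
    using that inj by (simp add: compose_def conj_map_def)
  have "?\<gamma> \<in> conj_homs S (carrier S) (\<phi> ` P) (\<phi> ` P) \<longleftrightarrow>
      (\<exists>h \<in> carrier S. ?\<gamma> = conj_map S (\<phi> ` P) h)"
    using val gP by (auto simp: conj_homs_def)
  also have "\<dots> \<longleftrightarrow> (\<exists>h \<in> carrier S. \<forall>x \<in> P. ?\<gamma> (\<phi> x) = conj_map S (\<phi> ` P) h (\<phi> x))"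
    by (intro bex_cong refl iffI) (auto intro!: extensionalityI[of _ "\<phi> ` P"] simp: conj_map_def)
  also have "\<dots> \<longleftrightarrow> (\<exists>h \<in> carrier S. \<forall>x \<in> P. \<phi> (g \<otimes> x \<otimes> inv g) = h \<otimes> \<phi> x \<otimes> inv h)"
    by (intro bex_cong ball_cong refl) (simp add: val, simp add: conj_map_def)
  finally show ?thesis using True by (simp add: extension_domain_def)
qed (simp add: extension_domain_def)

lemma extension_domain_le:
  assumes h: "\<phi> \<in> F P Q"
  shows "P \<subseteq> extension_domain S P \<phi>"
proof
  fix g assume g: "g \<in> P"
  then have "\<forall>x \<in> P. \<phi> (g \<otimes> x \<otimes> inv g) = \<phi> g \<otimes> \<phi> x \<otimes> inv (\<phi> g)" using hom_conj[OF h] by blast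
  then show "g \<in> extension_domain S P \<phi>"
    unfolding extension_domain_iff[OF h] using g hom_carrier[OF h g] le_normalizer[OF hom_source[OF h]] by blast
qed

end

section \<open>Extending morphisms to S\<close>

context fusion_system
begin

lemma commuting_conj:
  "\<lbrakk>g \<in> carrier S; x \<in> carrier S; g \<otimes> x = x \<otimes> g\<rbrakk> \<Longrightarrow> g \<otimes> x \<otimes> inv g = x"
  by (simp add: m_assoc)

lemma hom_inverse_image: "\<phi> \<in> F P Q \<Longrightarrow> restrict (inv_into P \<phi>) (\<phi> ` P) ` \<phi> ` P = P"
  using hom_inj by (force simp: image_iff)

lemma fully_normalised_conjugate:
  assumes P: "subgroup P S"
  shows "\<exists>\<rho> \<in> F P (carrier S). fully_normalised S F (\<rho> ` P)"
proof -
  let ?X = "{R. fs_isomorphic F P R}"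
  have "?X \<subseteq> Pow (carrier S)" using hom_carrier by (auto simp: fs_isomorphic_iff)
  then have fin: "finite ?X" using finite_S by (simp add: finite_subset)
  have "P \<in> ?X"
    unfolding fs_isomorphic_iff mem_Collect_eq
    using inclusion_hom[OF P subgroup_self subgroup.subset[OF P]] by (intro bexI) auto
  then have "(\<lambda>R. card (normalizer S R)) ` ?X \<noteq> {}" by blast
  from Max_in[OF finite_imageI[OF fin] this]
  obtain R where R: "fs_isomorphic F P R"
    "card (normalizer S R) = Max ((\<lambda>R. card (normalizer S R)) ` ?X)" by auto
  have "card (normalizer S R') \<le> card (normalizer S R)" if "fs_isomorphic F R R'" for R'
    unfolding R(2) using fin fs_isomorphic_trans[OF R(1) that] by (intro Max_ge) auto
  then have "fully_normalised S F R" by (simp add: fully_normalised_def)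
  then show ?thesis using R(1) by (auto simp: fs_isomorphic_iff)
qed

text \<open>The map $g \mapsto \rho c_g \rho^{-1}$. Its image is $\rho\,\mathrm{Aut}_S(P)\,\rho^{-1}$, which is thus a
  \<open>p\<close>-subgroup of $\mathrm{Aut}_{\mathcal{F}}(\rho(P))$.\<close>

lemma transport_hom:
  assumes r: "\<rho> \<in> F P (carrier S)"
  defines "\<tau> \<equiv> \<lambda>g. \<lambda>y\<in>\<rho> ` P. \<rho> (g \<otimes> inv_into P \<rho> y \<otimes> inv g)"
  shows "\<tau> \<in> hom (S\<lparr>carrier := normalizer S P\<rparr>) (aut_group F (\<rho> ` P))"
proof -
  let ?R = "\<rho> ` P"
  let ?s = "restrict (inv_into P \<rho>) ?R"
  note P = hom_source[OF r] and inj = hom_inj[OF r]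
  have cl: "g \<otimes> x \<otimes> inv g \<in> P" if "g \<in> normalizer S P" "x \<in> P" for g x
    using that P by (simp add: normalizer_finite_iff)
  have val: "\<tau> g (\<rho> x) = \<rho> (g \<otimes> x \<otimes> inv g)" if "x \<in> P" for g x
    using that inj by (simp add: \<tau>_def)
  have mem: "\<tau> g \<in> F ?R ?R" if g: "g \<in> normalizer S P" for g
  proof -
    have "compose ?R \<rho> (compose ?R (conj_map S P g) ?s) \<in> F ?R ?R"
      by (rule comp[OF comp[OF hom_inverse[OF r] conj_map_aut[OF P g]] hom_onto_image[OF r]])
    moreover have "compose ?R \<rho> (compose ?R (conj_map S P g) ?s) = \<tau> g"
      by (rule extensionalityI[of _ ?R]) (use val inj in \<open>auto simp: \<tau>_def compose_def conj_map_def\<close>)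
    ultimately show ?thesis by simp
  qed
  show ?thesis
  proof (rule homI)
    fix g assume "g \<in> carrier (S\<lparr>carrier := normalizer S P\<rparr>)"
    then show "\<tau> g \<in> carrier (aut_group F ?R)" using mem by simp
  next
    fix g h assume "g \<in> carrier (S\<lparr>carrier := normalizer S P\<rparr>)" "h \<in> carrier (S\<lparr>carrier := normalizer S P\<rparr>)"
    then have gh: "g \<in> normalizer S P" "h \<in> normalizer S P" by auto
    then have ghc: "g \<in> carrier S" "h \<in> carrier S" using P by (auto simp: normalizer_finite_iff)
    have "\<tau> (g \<otimes> h) = compose ?R (\<tau> g) (\<tau> h)"
    proof (rule extensionalityI[of _ ?R])
      fix y assume "y \<in> ?R"
      then obtain x where x: "x \<in> P" "y = \<rho> x" by blast
      have "\<tau> (g \<otimes> h) y = \<rho> (g \<otimes> (h \<otimes> x \<otimes> inv h) \<otimes> inv g)"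
        using x ghc P val by (simp add: conj_comp subgroup.mem_carrier)
      also have "\<dots> = \<tau> g (\<tau> h y)" using x val cl[OF gh(2)] by simp
      finally show "\<tau> (g \<otimes> h) y = compose ?R (\<tau> g) (\<tau> h) y" using x by (simp add: compose_def)
    qed (simp_all add: \<tau>_def compose_def)
    then show "\<tau> (g \<otimes>\<^bsub>S\<lparr>carrier := normalizer S P\<rparr>\<^esub> h) = \<tau> g \<otimes>\<^bsub>aut_group F ?R\<^esub> \<tau> h"
      using gh mem by (simp add: mult_aut_group)
  qed
qed

lemma inn_normal:
  assumes P: "subgroup P S"
  shows "conj_homs S P P P \<lhd> aut_group F P"
proof -
  interpret A: group "aut_group F P" by (rule aut_group_is_group[OF P])
  show ?thesis unfolding A.normal_inv_iff inn_eq[OF P]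
  proof (intro conjI ballI)
    show "subgroup (conj_map S P ` P) (aut_group F P)"
      by (rule conj_map_image(1)[OF P P le_normalizer[OF P]])
    fix \<alpha> \<beta> assume a: "\<alpha> \<in> carrier (aut_group F P)" and "\<beta> \<in> conj_map S P ` P"
    then obtain g where g: "g \<in> P" "\<beta> = conj_map S P g" by blast
    have a': "\<alpha> \<in> F P P" using a by simp
    note le = subsetD[OF le_normalizer[OF P]]
    have "\<alpha> \<otimes>\<^bsub>aut_group F P\<^esub> \<beta> \<otimes>\<^bsub>aut_group F P\<^esub> inv\<^bsub>aut_group F P\<^esub> \<alpha> = conj_map S P (\<alpha> g)"
      unfolding g(2) aut_conj_eq_iff[OF a' conj_map_aut[OF P le[OF g(1)]] conj_map_aut[OF P le[OF hom_closed[OF a' g(1)]]]]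
      using hom_conj[OF a' g(1)] hom_closed[OF a'] by (simp add: conj_map_def)
    then show "\<alpha> \<otimes>\<^bsub>aut_group F P\<^esub> \<beta> \<otimes>\<^bsub>aut_group F P\<^esub> inv\<^bsub>aut_group F P\<^esub> \<alpha> \<in> conj_map S P ` P"
      using hom_closed[OF a' g(1)] by simp
  qed
qed

lemma centricD:
  assumes P: "subgroup P S" and c: "fs_centric S F P"
    and g: "g \<in> carrier S" "\<And>x. x \<in> P \<Longrightarrow> g \<otimes> x = x \<otimes> g"
  shows "g \<in> P"
proof -
  have "fs_isomorphic F P P"
    unfolding fs_isomorphic_iff
    using inclusion_hom[OF P subgroup_self subgroup.subset[OF P]] by (intro bexI) auto
  then have "centraliser S P = centre S P" using c by (simp add: fs_centric_def)
  moreover have "g \<in> centraliser S P" using g by (simp add: centraliser_def)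
  ultimately show ?thesis by (simp add: centre_def centraliser_def)
qed

text \<open>If $c_g = c_r$ on \<open>P\<close> with \<open>r \<in> P\<close>, then $r^{-1}g$ centralises the centric subgroup \<open>P\<close>, so it lies in
  \<open>P\<close>.\<close>

lemma centric_conj_map_inner:
  assumes P: "subgroup P S" and c: "fs_centric S F P"
    and g: "g \<in> carrier S" and inn: "conj_map S P g \<in> conj_homs S P P P"
  shows "g \<in> P"
proof -
  obtain r where r: "r \<in> P" "conj_map S P g = conj_map S P r" using inn inn_eq[OF P] by auto
  have rc: "r \<in> carrier S" using r P by (auto dest: subgroup.mem_carrier)
  have eq: "g \<otimes> x \<otimes> inv g = r \<otimes> x \<otimes> inv r" if "x \<in> P" for x
    using r(2) conj_map_eq_iff[OF g rc] that by blast
  have "inv r \<otimes> g \<in> P"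
  proof (rule centricD[OF P c])
    show "inv r \<otimes> g \<in> carrier S" using rc g by simp
    fix x assume x: "x \<in> P"
    have xc: "x \<in> carrier S" using x P by (auto dest: subgroup.mem_carrier)
    have "inv r \<otimes> g \<otimes> x = inv r \<otimes> (g \<otimes> x \<otimes> inv g) \<otimes> g" using rc g xc by (simp add: m_assoc)
    also have "\<dots> = x \<otimes> (inv r \<otimes> g)"
      unfolding eq[OF x] using rc g xc by (simp add: m_assoc[symmetric])
    finally show "inv r \<otimes> g \<otimes> x = x \<otimes> (inv r \<otimes> g)" .
  qed
  then have "r \<otimes> (inv r \<otimes> g) \<in> P" using r P by (simp add: subgroup.m_closed)
  then show ?thesis using rc g by (simp add: m_assoc[symmetric])
qed

definition extends_to_S :: "'a set \<Rightarrow> ('a \<Rightarrow> 'a) \<Rightarrow> bool" where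
  "extends_to_S P \<phi> \<longleftrightarrow> (\<exists>\<psi> \<in> F (carrier S) (carrier S). \<forall>x \<in> P. \<psi> x = \<phi> x)"

lemma compose_image: "compose A g f ` A = g ` f ` A"
  by (auto simp: compose_def)

lemma extends_compose:
  assumes "extends_to_S Q \<beta>" "extends_to_S P \<alpha>" "\<alpha> ` P \<subseteq> Q" "P \<subseteq> carrier S"
  shows "extends_to_S P (compose P \<beta> \<alpha>)"
proof -
  obtain \<alpha>' \<beta>' where e: "\<alpha>' \<in> F (carrier S) (carrier S)" "\<forall>x \<in> P. \<alpha>' x = \<alpha> x"
    "\<beta>' \<in> F (carrier S) (carrier S)" "\<forall>x \<in> Q. \<beta>' x = \<beta> x"
    using assms by (auto simp: extends_to_S_def)
  have "compose (carrier S) \<beta>' \<alpha>' \<in> F (carrier S) (carrier S)" using e by (intro comp)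
  moreover have "\<forall>x \<in> P. compose (carrier S) \<beta>' \<alpha>' x = compose P \<beta> \<alpha> x"
    using e assms(3,4) by (auto simp: compose_def)
  ultimately show ?thesis unfolding extends_to_S_def by blast
qed

text \<open>Extensions to \<open>S\<close> are automorphisms of \<open>S\<close>, so they can be inverted.\<close>

lemma extends_cancel:
  assumes e: "extends_to_S P (compose P \<chi> \<phi>)" and c: "extends_to_S (\<phi> ` P) \<chi>"
    and im: "\<phi> ` P \<subseteq> carrier S" and P: "P \<subseteq> carrier S"
  shows "extends_to_S P \<phi>"
proof -
  obtain \<psi> \<chi>' where h: "\<psi> \<in> F (carrier S) (carrier S)" "\<forall>x \<in> P. \<psi> x = \<chi> (\<phi> x)"
    "\<chi>' \<in> F (carrier S) (carrier S)" "\<forall>y \<in> \<phi> ` P. \<chi>' y = \<chi> y"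
    using e c by (auto simp: extends_to_S_def compose_def)
  let ?i = "restrict (inv_into (carrier S) \<chi>') (carrier S)"
  have i: "?i \<in> F (carrier S) (carrier S)" using hom_inverse[OF h(3)] aut_image[OF h(3)] by simp
  have inv: "?i (\<chi>' y) = y" if "y \<in> carrier S" for y
    using that hom_inj[OF h(3)] hom_closed[OF h(3)] by simp
  have "compose (carrier S) ?i \<psi> \<in> F (carrier S) (carrier S)" using h i by (intro comp)
  moreover have "compose (carrier S) ?i \<psi> x = \<phi> x" if x: "x \<in> P" for x
  proof -
    have "compose (carrier S) ?i \<psi> x = ?i (\<chi>' (\<phi> x))"
      using x P h(2,4) by (auto simp: compose_def)
    also have "\<dots> = \<phi> x" using x im by (intro inv) blast
    finally show ?thesis .
  qed
  ultimately show ?thesis unfolding extends_to_S_def by blast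
qed

end

context saturated_fusion_system
begin

text \<open>By Sylow, $\rho$ can be followed by an automorphism $\alpha$ of the fully normalised subgroup
  $\rho(P)$ that moves $\rho\,\mathrm{Aut}_S(P)\,\rho^{-1}$ into the Sylow subgroup
  $\mathrm{Aut}_S(\rho(P))$. This says precisely that $N_{\alpha\rho} = N_S(P)$, and saturation extends
  $\alpha\rho$ to all of $N_S(P)$.\<close>

lemma fully_normalised_receptive:
  assumes r: "\<rho> \<in> F P (carrier S)" and fn: "fully_normalised S F (\<rho> ` P)"
  shows "\<exists>\<chi> \<in> F (normalizer S P) (carrier S). \<chi> ` P = \<rho> ` P"
proof -
  let ?R = "\<rho> ` P" and ?N = "normalizer S P"
  let ?A = "aut_group F ?R"
  note P = hom_source[OF r] and R = hom_image_subgroup[OF r] and inj = hom_inj[OF r]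
  interpret A: group ?A by (rule aut_group_is_group[OF R])
  define \<tau> where "\<tau> = (\<lambda>g. \<lambda>y\<in>?R. \<rho> (g \<otimes> inv_into P \<rho> y \<otimes> inv g))"
  have \<tau>: "\<tau> \<in> hom (S\<lparr>carrier := ?N\<rparr>) ?A" unfolding \<tau>_def by (rule transport_hom[OF r])
  have val: "\<tau> g (\<rho> x) = \<rho> (g \<otimes> x \<otimes> inv g)" if "x \<in> P" for g x
    using that inj by (simp add: \<tau>_def)
  have N: "subgroup ?N S" by (rule normalizer_subgroup[OF P])
  obtain n where n: "card ?N = p ^ n" using subgroup_p_card[OF N] by blast
  interpret N: group "S\<lparr>carrier := ?N\<rparr>" by (rule subgroup_imp_group[OF N])
  have "subgroup ?N (S\<lparr>carrier := ?N\<rparr>)" using N.subgroup_self by simp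
  note K = N.p_subgroup_hom_image[OF \<tau> A.is_group this prime_p n]
  then obtain m where m: "card (\<tau> ` ?N) = p ^ m" by blast
  have syl: "fully_centralised S F ?R" "sylow_subgroup p ?A (conj_homs S (carrier S) ?R ?R)"
    using fully_normalised_sylow[OF R fn] by auto
  obtain \<alpha> where \<alpha>: "\<alpha> \<in> F ?R ?R"
    and conj: "\<forall>k \<in> \<tau> ` ?N. \<alpha> \<otimes>\<^bsub>?A\<^esub> k \<otimes>\<^bsub>?A\<^esub> inv\<^bsub>?A\<^esub> \<alpha> \<in> conj_homs S (carrier S) ?R ?R"
    using A.p_subgroup_conjugate_into_sylow[OF _ prime_p syl(2) K(1) m] finite_aut by auto
  define \<phi> where "\<phi> = compose P \<alpha> \<rho>"
  have \<phi>: "\<phi> \<in> F P (carrier S)"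
    unfolding \<phi>_def by (rule hom_into_S[OF comp[OF hom_onto_image[OF r] \<alpha>]])
  have im: "\<phi> ` P = ?R" using aut_image[OF \<alpha>] by (auto simp: \<phi>_def compose_def image_image[symmetric])
  have "g \<in> extension_domain S P \<phi>" if g: "g \<in> ?N" for g
  proof -
    have gP: "g \<otimes> x \<otimes> inv g \<in> P" if "x \<in> P" for x using g P that by (simp add: normalizer_finite_iff)
    have \<tau>g: "\<tau> g \<in> F ?R ?R" using \<tau> g by (auto simp: hom_def)
    obtain h where h: "h \<in> normalizer S ?R"
      "\<alpha> \<otimes>\<^bsub>?A\<^esub> \<tau> g \<otimes>\<^bsub>?A\<^esub> inv\<^bsub>?A\<^esub> \<alpha> = conj_map S ?R h"
      using conj g by (auto simp: aut_S_eq[OF R])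
    have eq: "\<alpha> (\<tau> g y) = conj_map S ?R h (\<alpha> y)" if "y \<in> ?R" for y
      using h(2) that unfolding aut_conj_eq_iff[OF \<alpha> \<tau>g conj_map_aut[OF R h(1)]] by blast
    have "\<phi> (g \<otimes> x \<otimes> inv g) = h \<otimes> \<phi> x \<otimes> inv h" if x: "x \<in> P" for x
    proof -
      have "\<phi> (g \<otimes> x \<otimes> inv g) = \<alpha> (\<tau> g (\<rho> x))" using x gP val by (simp add: \<phi>_def compose_def)
      also have "\<dots> = h \<otimes> \<alpha> (\<rho> x) \<otimes> inv h"
        using eq[of "\<rho> x"] x hom_closed[OF \<alpha>] by (simp add: conj_map_def)
      finally show ?thesis using x by (simp add: \<phi>_def compose_def)
    qed
    moreover have "h \<in> carrier S" using h R by (simp add: normalizer_finite_iff)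
    ultimately show ?thesis unfolding extension_domain_iff[OF \<phi>] using g by blast
  qed
  then have dom: "extension_domain S P \<phi> = ?N" by (auto simp: extension_domain_def)
  have "fully_centralised S F (\<phi> ` P)" using syl(1) im by simp
  from extension[OF \<phi> this] obtain \<chi> where \<chi>: "\<chi> \<in> F ?N (carrier S)" "restrict \<chi> P = \<phi>"
    unfolding dom by blast
  have "\<chi> ` P = ?R" using \<chi>(2) im by (metis image_restrict_eq)
  then show ?thesis using \<chi>(1) by blast
qed

text \<open>If \<open>R\<close> contained its centraliser, then so would every $\mathcal{F}$-isomorphic $\rho(R)$: the inverse of
  $\rho$ extends to the centraliser of $\rho(R)$, which it maps injectively into $C_S(R) \le R$, and all
  of \<open>R\<close> is already the image of $\rho(R)$.\<close>

lemma not_centric_centraliser: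
  assumes R: "subgroup R S" and fc: "fully_centralised S F R" and nc: "\<not> fs_centric S F R"
  shows "\<exists>g \<in> carrier S - R. \<forall>x \<in> R. g \<otimes> x = x \<otimes> g"
proof (rule ccontr)
  assume none: "\<not> ?thesis"
  obtain \<rho> where r: "\<rho> \<in> F R (carrier S)" and ne: "centraliser S (\<rho> ` R) \<noteq> centre S (\<rho> ` R)"
    using nc by (auto simp: fs_centric_def fs_isomorphic_iff)
  let ?T = "\<rho> ` R"
  have T: "subgroup ?T S" by (rule hom_image_subgroup[OF r])
  then obtain c where c: "c \<in> carrier S" "\<forall>x \<in> ?T. c \<otimes> x = x \<otimes> c" "c \<notin> ?T"
    using ne by (auto simp: centre_def centraliser_def dest: subgroup.mem_carrier)
  define \<sigma> where "\<sigma> = restrict (inv_into R \<rho>) ?T"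
  have s: "\<sigma> \<in> F ?T R" unfolding \<sigma>_def by (rule hom_inverse[OF r])
  have im: "\<sigma> ` ?T = R" using hom_inverse_image[OF r] by (simp add: \<sigma>_def)
  have triv: "c \<otimes> x \<otimes> inv c = x" if "x \<in> ?T" for x
    using commuting_conj[OF c(1) subgroup.mem_carrier[OF T that]] c(2) that by blast
  \<comment> \<open>\<open>c\<close> acts trivially, so \<open>\<one>\<close> witnesses its membership in $N_\sigma$.\<close>
  have cdom: "c \<in> extension_domain S ?T \<sigma>"
    unfolding extension_domain_iff[OF s] normalizer_finite_iff[OF T]
    using c(1) triv hom_carrier[OF s] by (auto intro!: bexI[of _ \<one>])
  obtain \<psi> where \<psi>: "\<psi> \<in> F (extension_domain S ?T \<sigma>) (carrier S)" "restrict \<psi> ?T = \<sigma>"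
    using extension[OF hom_into_S[OF s]] im fc by auto
  have \<psi>T: "\<psi> x = \<sigma> x" if "x \<in> ?T" for x using \<psi>(2) that by (metis restrict_apply')
  note dom = subsetD[OF extension_domain_le[OF s]]
  have "\<psi> c \<otimes> y = y \<otimes> \<psi> c" if y: "y \<in> R" for y
  proof -
    obtain x where x: "x \<in> ?T" "y = \<sigma> x" using y im by blast
    then show ?thesis
      using hom_mult[OF \<psi>(1) cdom dom[OF x(1)]] hom_mult[OF \<psi>(1) dom[OF x(1)] cdom] c(2) \<psi>T by metis
  qed
  then have "\<psi> c \<in> R" using none hom_carrier[OF \<psi>(1) cdom] by blast
  then obtain x where x: "x \<in> ?T" "\<psi> c = \<psi> x" using im \<psi>T by (metis imageE)
  then have "c = x" using hom_inj[OF \<psi>(1)] cdom dom by (meson inj_onD)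
  then show False using c x by blast
qed

text \<open>The automorphisms of \<open>R\<close> that extend to \<open>S\<close> form a subgroup \<open>H\<close> containing $\mathrm{Aut}_S(R)$. If an
  automorphism $\gamma$ conjugates a non-inner $c_g \in \mathrm{Aut}_S(R)$ into $\mathrm{Aut}_S(R)$, then
  $g \in N_\gamma - R$, so $\gamma \in H$ by assumption. Were \<open>H\<close> proper, its image in
  $\mathrm{Out}_{\mathcal{F}}(R)$ would thus be strongly embedded, and \<open>R\<close> would be essential.\<close>

lemma aut_extends_if_not_essential:
  assumes R: "subgroup R S" and fn: "fully_normalised S F R" and c: "fs_centric S F R"
    and ne: "R \<notin> essential_subgroups p S F" and proper: "R \<noteq> carrier S"
    and ext: "\<And>\<beta> g. \<lbrakk>\<beta> \<in> F R R; g \<in> extension_domain S R \<beta>; g \<notin> R\<rbrakk> \<Longrightarrow> extends_to_S R \<beta>"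
    and b: "\<beta> \<in> F R R"
  shows "extends_to_S R \<beta>"
proof (rule ccontr)
  assume nb: "\<not> extends_to_S R \<beta>"
  let ?A = "aut_group F R"
  interpret A: group ?A by (rule aut_group_is_group[OF R])
  define H where "H = {\<alpha> \<in> F R R. extends_to_S R \<alpha>}"
  let ?I = "conj_homs S R R R" and ?T = "conj_homs S (carrier S) R R"
  note Rc = subgroup.subset[OF R]
  have syl: "sylow_subgroup p ?A ?T" using fully_normalised_sylow[OF R fn] by blast
  obtain i where i: "card ?I = p ^ i"
    using conj_map_image(2)[OF R R le_normalizer[OF R]] inn_eq[OF R] by auto
  have TH: "?T \<subseteq> H"
  proof
    fix \<gamma> assume "\<gamma> \<in> ?T"
    then obtain g where g: "g \<in> normalizer S R" "\<gamma> = conj_map S R g" using aut_S_eq[OF R] by auto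
    have gc: "g \<in> carrier S" using g R by (simp add: normalizer_finite_iff)
    have "conj_map S (carrier S) g \<in> F (carrier S) (carrier S)"
      using gc by (intro conj_hom subgroup_self) auto
    then have "extends_to_S R \<gamma>"
      unfolding extends_to_S_def g(2) using Rc by (intro bexI) (auto simp: conj_map_def)
    then show "\<gamma> \<in> H" using conj_map_aut[OF R g(1)] g(2) by (simp add: H_def)
  qed
  have Hsub: "subgroup H ?A"
  proof (rule A.subgroupI)
    show "H \<subseteq> carrier ?A" by (auto simp: H_def)
    show "H \<noteq> {}" using TH syl A.subgroup_self by (auto simp: sylow_subgroup_def dest: subgroup.one_closed)
    fix \<alpha> assume a: "\<alpha> \<in> H"
    then have aF: "\<alpha> \<in> F R R" and ae: "extends_to_S R \<alpha>" by (auto simp: H_def)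
    have iF: "inv\<^bsub>?A\<^esub> \<alpha> \<in> F R R" using A.inv_closed aF by simp
    have "compose R \<alpha> (inv\<^bsub>?A\<^esub> \<alpha>) = (\<lambda>x\<in>R. x)"
      using A.r_inv[of \<alpha>] aF iF by (simp add: mult_aut_group one_aut_group)
    moreover have "extends_to_S R (\<lambda>x\<in>R. x)"
      unfolding extends_to_S_def using inclusion_hom[OF subgroup_self subgroup_self] Rc by (intro bexI) auto
    ultimately have "extends_to_S R (compose R \<alpha> (inv\<^bsub>?A\<^esub> \<alpha>))" by (simp only:)
    then have "extends_to_S R (inv\<^bsub>?A\<^esub> \<alpha>)"
      by (rule extends_cancel) (use ae Rc aut_image[OF iF] in simp_all)
    then show "inv\<^bsub>?A\<^esub> \<alpha> \<in> H" using iF by (simp add: H_def)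
    fix \<gamma> assume g: "\<gamma> \<in> H"
    show "\<alpha> \<otimes>\<^bsub>?A\<^esub> \<gamma> \<in> H"
      using a g extends_compose[of R \<alpha> R \<gamma>] comp[of \<gamma> R R \<alpha> R] aut_image[of \<gamma> R] Rc
      by (simp add: H_def mult_aut_group)
  qed
  have Hne: "H \<noteq> carrier ?A" using nb b by (auto simp: H_def)
  have IT: "?I \<subset> ?T"
  proof -
    obtain n where "order S = p ^ n" using order_p_power by blast
    then obtain g where g: "g \<in> normalizer S R" "g \<notin> R"
      using normalizer_grows[OF prime_p _ R proper] by blast
    have "conj_map S R g \<in> ?T" using g aut_S_eq[OF R] by blast
    moreover have "conj_map S R g \<notin> ?I"
      using centric_conj_map_inner[OF R c] g R by (auto simp: normalizer_finite_iff)
    moreover have "?I \<subseteq> ?T" using aut_S_eq[OF R] inn_eq[OF R] le_normalizer[OF R] by auto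
    ultimately show ?thesis by blast
  qed
  have control: "\<gamma> \<in> H"
    if k: "k \<in> ?T - ?I" and \<gamma>: "\<gamma> \<in> carrier ?A" and kT: "\<gamma> \<otimes>\<^bsub>?A\<^esub> k \<otimes>\<^bsub>?A\<^esub> inv\<^bsub>?A\<^esub> \<gamma> \<in> ?T" for k \<gamma>
  proof -
    have \<gamma>F: "\<gamma> \<in> F R R" using \<gamma> by simp
    obtain g where g: "g \<in> normalizer S R" "k = conj_map S R g" using k aut_S_eq[OF R] by auto
    obtain h where h: "h \<in> normalizer S R" "\<gamma> \<otimes>\<^bsub>?A\<^esub> k \<otimes>\<^bsub>?A\<^esub> inv\<^bsub>?A\<^esub> \<gamma> = conj_map S R h"
      using kT aut_S_eq[OF R] by auto
    have "\<gamma> (conj_map S R g x) = conj_map S R h (\<gamma> x)" if "x \<in> R" for x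
      using h(2) that unfolding g(2) aut_conj_eq_iff[OF \<gamma>F conj_map_aut[OF R g(1)] conj_map_aut[OF R h(1)]]
      by blast
    then have "\<forall>x \<in> R. \<gamma> (g \<otimes> x \<otimes> inv g) = h \<otimes> \<gamma> x \<otimes> inv h"
      using hom_closed[OF \<gamma>F] by (simp add: conj_map_def)
    then have "g \<in> extension_domain S R \<gamma>"
      unfolding extension_domain_iff[OF \<gamma>F] using g(1) h(1) R by (auto simp: normalizer_finite_iff)
    moreover have "g \<notin> R" using k g inn_eq[OF R] by auto
    ultimately show ?thesis using ext \<gamma>F by (simp add: H_def)
  qed
  have "strongly_p_embedded p (?A Mod ?I) ((\<lambda>\<alpha>. ?I #>\<^bsub>?A\<^esub> \<alpha>) ` H)"
  proof (rule A.strongly_p_embedded_ModI[OF _ prime_p inn_normal[OF R] i Hsub Hne syl TH IT])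
    show "finite (carrier ?A)" using finite_aut by simp
  qed (rule control)
  then show False using ne R fn c by (auto simp: essential_subgroups_def out_group_def)
qed

text \<open>A form of Alperin's fusion theorem: on a family closed under $\mathcal{F}$-conjugation and overgroups
  that avoids the essential subgroups, all fusion comes from automorphisms of \<open>S\<close>. The
  induction goes from large to small \<open>P\<close>. Let \<open>R\<close> be a fully normalised conjugate of \<open>P\<close>. The
  isomorphisms of \<open>P\<close> and of $\varphi(P)$ onto \<open>R\<close> may be chosen to extend to the normalisers, which are
  larger, so by induction they extend to \<open>S\<close>. This leaves an automorphism of \<open>R\<close>. If \<open>R\<close> is not centric,
  it extends to $R\,C_S(R)$, which is larger again; otherwise \<open>aut_extends_if_not_essential\<close>
  applies.\<close>

theorem extends_if_no_essential:
  assumes up: "\<And>P R. \<lbrakk>P \<in> \<C>; subgroup R S; P \<subseteq> R\<rbrakk> \<Longrightarrow> R \<in> \<C>"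
    and conj: "\<And>P \<phi>. \<lbrakk>P \<in> \<C>; \<phi> \<in> F P (carrier S)\<rbrakk> \<Longrightarrow> \<phi> ` P \<in> \<C>"
    and ne: "\<C> \<inter> essential_subgroups p S F = {}"
    and P: "P \<in> \<C>" and h: "\<phi> \<in> F P (carrier S)"
  shows "extends_to_S P \<phi>"
  using P h
proof (induction "card (carrier S) - card P" arbitrary: P \<phi> rule: less_induct)
  case less
  note PX = less.prems(1) and h = less.prems(2)
  note P = hom_source[OF h]
  show ?case
  proof (cases "P = carrier S")
    case True
    then show ?thesis using h by (auto simp: extends_to_S_def)
  next
    case False
    have small: "card P < card (carrier S)"
      using False subgroup.subset[OF P] finite_S by (simp add: psubset_card_mono psubsetI)
    have IH: "extends_to_S D \<psi>"
      if "D \<in> \<C>" "\<psi> \<in> F D (carrier S)" "Q \<subset> D" "card Q = card P" for D \<psi> Q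
    proof (rule less.hyps[OF _ that(1,2)])
      have "card Q < card D" by (rule psubset_card_mono[OF finite_subgroup[OF hom_source[OF that(2)]] that(3)])
      then show "card (carrier S) - card D < card (carrier S) - card P" using that small by simp
    qed
    obtain \<rho> where \<rho>: "\<rho> \<in> F P (carrier S)" and fn: "fully_normalised S F (\<rho> ` P)"
      using fully_normalised_conjugate[OF P] by blast
    let ?R = "\<rho> ` P"
    have R: "subgroup ?R S" by (rule hom_image_subgroup[OF \<rho>])
    have RX: "?R \<in> \<C>" by (rule conj[OF PX \<rho>])
    have cR: "card ?R = card P" using card_image[OF hom_inj[OF \<rho>]] .
    have fc: "fully_centralised S F ?R" using fully_normalised_sylow[OF R fn] by blast
    have proper: "?R \<noteq> carrier S" using cR small by auto
    \<comment> \<open>An automorphism of \<open>?R\<close> whose extension domain is larger than \<open>?R\<close> is covered by induction.\<close>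
    have up1: "extends_to_S ?R \<beta>"
      if \<beta>: "\<beta> \<in> F ?R ?R" and g: "g \<in> extension_domain S ?R \<beta>" "g \<notin> ?R" for \<beta> g
    proof -
      obtain \<psi> where \<psi>: "\<psi> \<in> F (extension_domain S ?R \<beta>) (carrier S)" "restrict \<psi> ?R = \<beta>"
        using extension[OF hom_into_S[OF \<beta>]] aut_image[OF \<beta>] fc by auto
      have less: "?R \<subset> extension_domain S ?R \<beta>" using extension_domain_le[OF \<beta>] g by blast
      have "extends_to_S (extension_domain S ?R \<beta>) \<psi>"
        using up[OF RX hom_source[OF \<psi>(1)]] less by (intro IH[OF _ \<psi>(1) less cR]) auto
      then obtain \<omega> where "\<omega> \<in> F (carrier S) (carrier S)" "\<forall>x \<in> extension_domain S ?R \<beta>. \<omega> x = \<psi> x"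
        by (auto simp: extends_to_S_def)
      moreover have "\<psi> x = \<beta> x" if "x \<in> ?R" for x using fun_cong[OF \<psi>(2), of x] that by simp
      ultimately have "\<omega> \<in> F (carrier S) (carrier S) \<and> (\<forall>x \<in> ?R. \<omega> x = \<beta> x)"
        using psubsetD[OF less] by simp
      then show ?thesis unfolding extends_to_S_def by blast
    qed
    have aut: "extends_to_S ?R \<beta>" if \<beta>: "\<beta> \<in> F ?R ?R" for \<beta>
    proof (cases "fs_centric S F ?R")
      case True
      have "?R \<notin> essential_subgroups p S F" using RX ne by blast
      from aut_extends_if_not_essential[OF R fn True this proper up1 \<beta>] show ?thesis .
    next
      case False
      obtain g where g: "g \<in> carrier S" "g \<notin> ?R" "\<forall>x \<in> ?R. g \<otimes> x = x \<otimes> g"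
        using not_centric_centraliser[OF R fc False] by blast
      have "g \<otimes> x \<otimes> inv g = x" if "x \<in> ?R" for x
        using commuting_conj[OF g(1) subgroup.mem_carrier[OF R that]] g(3) that by blast
      then have "g \<in> extension_domain S ?R \<beta>"
        unfolding extension_domain_iff[OF \<beta>] normalizer_finite_iff[OF R]
        using g(1) hom_carrier[OF \<beta>] by (auto intro!: bexI[of _ \<one>])
      then show ?thesis using up1[OF \<beta>] g by blast
    qed
    have recep: "\<exists>\<chi> \<in> F Q (carrier S). \<chi> ` Q = ?R \<and> extends_to_S Q \<chi>"
      if \<theta>: "\<theta> \<in> F P (carrier S)" "Q = \<theta> ` P" for \<theta> Q
    proof -
      have Q: "subgroup Q S" using that hom_image_subgroup by blast
      have QX: "Q \<in> \<C>" using conj[OF PX] that by blast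
      have cQ: "card Q = card P" using that card_image[OF hom_inj] by blast
      have "Q \<noteq> carrier S" using cQ small by auto
      then obtain g where g: "g \<in> normalizer S Q" "g \<notin> Q"
        using normalizer_grows[OF prime_p _ Q] order_p_power by blast
      have "fs_isomorphic F Q P"
        unfolding fs_isomorphic_iff \<theta>(2)
        using hom_into_S[OF hom_inverse[OF \<theta>(1)]] hom_inverse_image[OF \<theta>(1)] by blast
      then have "fs_isomorphic F Q ?R" using fs_isomorphic_trans \<rho> fs_isomorphic_iff by blast
      then obtain \<mu> where "\<mu> \<in> F Q (carrier S)" "\<mu> ` Q = ?R" by (auto simp: fs_isomorphic_iff)
      then obtain \<chi> where \<chi>: "\<chi> \<in> F (normalizer S Q) (carrier S)" "\<chi> ` Q = ?R"
        using fully_normalised_receptive[of \<mu> Q] fn by auto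
      have less: "Q \<subset> normalizer S Q" using g le_normalizer[OF Q] by blast
      have "extends_to_S (normalizer S Q) \<chi>"
        using up[OF QX normalizer_subgroup[OF Q]] less by (intro IH[OF _ \<chi>(1) less cQ]) auto
      then have "extends_to_S Q (restrict \<chi> Q)" using less by (auto simp: extends_to_S_def)
      moreover have "restrict \<chi> Q \<in> F Q (carrier S)" using hom_restrict[OF \<chi>(1) Q] less by blast
      ultimately show ?thesis using \<chi>(2) by (intro bexI[of _ "restrict \<chi> Q"]) simp_all
    qed
    have "P = (\<lambda>x\<in>P. x) ` P" by simp
    from recep[OF inclusion_hom[OF P subgroup_self subgroup.subset[OF P]] this]
    obtain \<chi> where c: "\<chi> \<in> F P (carrier S)" "\<chi> ` P = ?R" "extends_to_S P \<chi>" by blast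
    obtain \<omega> where o: "\<omega> \<in> F (\<phi> ` P) (carrier S)" "\<omega> ` (\<phi> ` P) = ?R" "extends_to_S (\<phi> ` P) \<omega>"
      using recep[OF h refl] by blast
    \<comment> \<open>$\beta = \omega\varphi\chi^{-1}$ is an automorphism of \<open>?R\<close>, and $\varphi = \omega^{-1}\beta\chi$.\<close>
    define \<sigma> where "\<sigma> = restrict (inv_into P \<chi>) ?R"
    have s: "\<sigma> \<in> F ?R P" "\<sigma> ` ?R = P"
      using hom_inverse[OF c(1)] hom_inverse_image[OF c(1)] c(2) by (simp_all add: \<sigma>_def)
    define \<beta> where "\<beta> = compose ?R \<omega> (compose ?R \<phi> \<sigma>)"
    have b: "\<beta> \<in> F ?R (carrier S)"
      unfolding \<beta>_def by (rule comp[OF comp[OF s(1) hom_onto_image[OF h]] o(1)])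
    have "\<beta> ` ?R = ?R"
      unfolding \<beta>_def compose_image s(2) o(2) ..
    then have "\<beta> \<in> F ?R ?R" by (intro hom_codomain[OF b R]) (rule equalityD1)
    then have "extends_to_S P (compose P \<beta> \<chi>)"
      using aut c subgroup.subset[OF P] by (intro extends_compose[of ?R]) simp_all
    moreover have "compose P \<beta> \<chi> x = compose P \<omega> \<phi> x" for x
    proof (cases "x \<in> P")
      case True
      have "\<chi> x \<in> ?R" using True c(2) by blast
      moreover have "\<sigma> (\<chi> x) = x"
        using inv_into_f_f[OF hom_inj[OF c(1)] True] \<open>\<chi> x \<in> ?R\<close> by (simp add: \<sigma>_def)
      ultimately show ?thesis using True by (simp add: \<beta>_def compose_def)
    qed (simp add: compose_def)
    ultimately have "extends_to_S P (compose P \<omega> \<phi>)" by (simp add: extends_to_S_def)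
    then show ?thesis by (rule extends_cancel[OF _ o(3)])
      (use hom_carrier[OF h] subgroup.subset[OF P] in blast)+
  qed
qed

end

section \<open>Essential and radical subgroups\<close>

lemma (in group) normal_image_Mod:
  assumes I: "I \<lhd> G" and N: "N \<lhd> G"
  shows "(\<lambda>a. I #> a) ` N \<lhd> G Mod I"
proof -
  interpret I: normal I G by (rule I)
  interpret Q: group "G Mod I" by (rule I.factorgroup_is_group)
  interpret pi: group_hom G "G Mod I" "\<lambda>a. I #> a"
    by (intro group_hom.intro group_hom_axioms.intro is_group Q.is_group I.r_coset_hom_Mod)
  show ?thesis unfolding Q.normal_inv_iff
  proof (intro conjI ballI)
    show "subgroup ((\<lambda>a. I #> a) ` N) (G Mod I)"
      by (rule pi.subgroup_img_is_subgroup[OF normal_imp_subgroup[OF N]])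
    fix Y Z assume "Y \<in> carrier (G Mod I)" "Z \<in> (\<lambda>a. I #> a) ` N"
    then obtain g n where gn: "g \<in> carrier G" "Y = I #> g" "n \<in> N" "Z = I #> n"
      by (auto simp: FactGroup_def RCOSETS_def)
    have nc: "n \<in> carrier G" using gn N by (meson normal_imp_subgroup subgroup.mem_carrier)
    have "Y \<otimes>\<^bsub>G Mod I\<^esub> Z \<otimes>\<^bsub>G Mod I\<^esub> inv\<^bsub>G Mod I\<^esub> Y = I #> (g \<otimes> n \<otimes> inv g)"
      using gn nc by simp
    then show "Y \<otimes>\<^bsub>G Mod I\<^esub> Z \<otimes>\<^bsub>G Mod I\<^esub> inv\<^bsub>G Mod I\<^esub> Y \<in> (\<lambda>a. I #> a) ` N"
      using normal.inv_op_closed2[OF N gn(1,3)] by blast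
  qed
qed

context fusion_system
begin

lemma out_group_is_group: "subgroup P S \<Longrightarrow> group (out_group S F P)"
  unfolding out_group_def using inn_normal normal.factorgroup_is_group by blast

lemma finite_out_group: "finite (carrier (out_group S F P))"
  by (simp add: out_group_def FactGroup_def RCOSETS_def finite_aut)

lemma radicalD:
  assumes P: "subgroup P S" and rad: "fs_radical p S F P"
    and N: "N \<lhd> aut_group F P" and cN: "card N = p ^ n"
  shows "N \<subseteq> conj_homs S P P P"
proof
  let ?A = "aut_group F P" and ?I = "conj_homs S P P P"
  interpret A: group ?A by (rule aut_group_is_group[OF P])
  interpret I: normal ?I ?A by (rule inn_normal[OF P])
  interpret Q: group "?A Mod ?I" by (rule I.factorgroup_is_group)
  have Ns: "subgroup N ?A" using N by (rule normal_imp_subgroup)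
  obtain m where m: "card ((\<lambda>a. ?I #>\<^bsub>?A\<^esub> a) ` N) = p ^ m"
    using A.p_subgroup_hom_image(2)[OF I.r_coset_hom_Mod Q.is_group Ns prime_p cN] by blast
  have "(\<lambda>a. ?I #>\<^bsub>?A\<^esub> a) ` N \<subseteq> p_core p (?A Mod ?I)"
    using Q.normal_le_p_core[OF _ prime_p A.normal_image_Mod[OF inn_normal[OF P] N] m]
      finite_out_group[of P] by (simp add: out_group_def)
  then have triv: "?I #>\<^bsub>?A\<^esub> a = ?I" if "a \<in> N" for a
    using rad that by (auto simp: fs_radical_def out_group_def FactGroup_def)
  fix a assume a: "a \<in> N"
  have "a \<in> ?I #>\<^bsub>?A\<^esub> a"
    by (rule A.rcos_self[OF subgroup.mem_carrier[OF Ns a] I.is_subgroup])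
  then show "a \<in> ?I" using triv[OF a] by simp
qed

lemma essential_radical:
  assumes E: "P \<in> essential_subgroups p S F"
  shows "fs_radical p S F P"
proof -
  obtain H where P: "subgroup P S" and H: "strongly_p_embedded p (out_group S F P) H"
    using E by (auto simp: essential_subgroups_def)
  interpret out: group "out_group S F P" by (rule out_group_is_group[OF P])
  show ?thesis
    unfolding fs_radical_def
    using out.strongly_p_embedded_normal_p_trivial[OF finite_out_group prime_p H]
    by (intro p_core_trivialI out.is_group)
qed

text \<open>With this, the recursion for the local rank looks at every essential subgroup that properly contains
  the core.\<close>

lemma essential_fcr: "essential_subgroups p S F \<subseteq> fcr_subgroups p S F"
  using essential_radical by (auto simp: essential_subgroups_def fcr_subgroups_def)

text \<open>The extensions normalise \<open>D\<close>, so $\alpha c_g \alpha^{-1} = c_{\psi(g)}$ shows that $\mathrm{Aut}_D(P)$ is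
  a normal \<open>p\<close>-subgroup of $\mathrm{Aut}_{\mathcal{F}}(P)$. As \<open>P\<close> is radical it consists of inner
  automorphisms, and as \<open>P\<close> is centric this means \<open>D \<subseteq> P\<close>.\<close>

lemma radical_centric_extensions:
  assumes P: "subgroup P S" and c: "fs_centric S F P" and rad: "fs_radical p S F P"
    and D: "subgroup D S" "P \<subseteq> D" "D \<subseteq> normalizer S P"
    and ext: "\<And>\<alpha>. \<alpha> \<in> F P P \<Longrightarrow> \<exists>\<psi> \<in> F D D. \<forall>x \<in> P. \<psi> x = \<alpha> x"
  shows "D = P"
proof -
  let ?A = "aut_group F P"
  interpret A: group ?A by (rule aut_group_is_group[OF P])
  note N = conj_map_image[OF P D(1,3)]
  have "conj_map S P ` D \<lhd> ?A"
    unfolding A.normal_inv_iff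
  proof (intro conjI ballI N(1))
    fix \<alpha> \<beta> assume "\<alpha> \<in> carrier ?A" and "\<beta> \<in> conj_map S P ` D"
    then obtain g where a: "\<alpha> \<in> F P P" and g: "g \<in> D" "\<beta> = conj_map S P g" by auto
    obtain \<psi> where \<psi>: "\<psi> \<in> F D D" "\<forall>x \<in> P. \<psi> x = \<alpha> x" using ext[OF a] by blast
    have gN: "g \<in> normalizer S P" using g D by blast
    have hD: "\<psi> g \<in> D" by (rule hom_closed[OF \<psi>(1) g(1)])
    then have hN: "\<psi> g \<in> normalizer S P" using D by blast
    have "\<alpha> (conj_map S P g x) = conj_map S P (\<psi> g) (\<alpha> x)" if x: "x \<in> P" for x
    proof -
      have gx: "g \<otimes> x \<otimes> inv g \<in> P" using gN x P by (simp add: normalizer_finite_iff)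
      have "\<alpha> (g \<otimes> x \<otimes> inv g) = \<psi> (g \<otimes> x \<otimes> inv g)" using \<psi>(2) gx by simp
      also have "\<dots> = \<psi> g \<otimes> \<psi> x \<otimes> inv (\<psi> g)" using hom_conj[OF \<psi>(1) g(1)] x D(2) by blast
      finally show ?thesis using x \<psi>(2) hom_closed[OF a x] by (simp add: conj_map_def)
    qed
    then have "\<alpha> \<otimes>\<^bsub>?A\<^esub> \<beta> \<otimes>\<^bsub>?A\<^esub> inv\<^bsub>?A\<^esub> \<alpha> = conj_map S P (\<psi> g)"
      unfolding g(2) using aut_conj_eq_iff[OF a conj_map_aut[OF P gN] conj_map_aut[OF P hN]] by blast
    then show "\<alpha> \<otimes>\<^bsub>?A\<^esub> \<beta> \<otimes>\<^bsub>?A\<^esub> inv\<^bsub>?A\<^esub> \<alpha> \<in> conj_map S P ` D" using hD by blast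
  qed
  then have le: "conj_map S P ` D \<subseteq> conj_homs S P P P" using radicalD[OF P rad] N(2) by blast
  have "D \<subseteq> P"
    using centric_conj_map_inner[OF P c] le subgroup.mem_carrier[OF D(1)] by blast
  then show ?thesis using D(2) by blast
qed

lemma normalizer_eq_self:
  assumes P: "subgroup P S" and eq: "normalizer S P = P"
  shows "P = carrier S"
  using normalizer_grows[OF prime_p _ P] order_p_power eq by blast

text \<open>Automorphisms of \<open>P\<close> extend to \<open>P <#> Q\<close> because \<open>Q\<close> is normal, and the extensions preserve the
  normaliser of \<open>P\<close> in \<open>P <#> Q\<close>. Hence that normaliser is \<open>P\<close> itself, and so is \<open>P <#> Q\<close>.\<close>

lemma essential_contains_normal:
  assumes E: "P \<in> essential_subgroups p S F" and Q: "fs_normal S F Q"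
  shows "Q \<subseteq> P"
proof -
  have P: "subgroup P S" and c: "fs_centric S F P"
    using E by (auto simp: essential_subgroups_def)
  have Qs: "subgroup Q S" using Q by (simp add: fs_normal_def)
  let ?PQ = "P <#> Q"
  have PQ: "subgroup ?PQ S"
    using fs_normalD(2)[OF Q inclusion_hom[OF P P subset_refl]] hom_source by blast
  have le: "P \<subseteq> ?PQ" "Q \<subseteq> ?PQ"
    using subgroup.one_closed[OF P] subgroup.one_closed[OF Qs] subgroup.mem_carrier[OF P]
      subgroup.mem_carrier[OF Qs] r_one l_one unfolding set_mult_def by (force, force)
  define D where "D = normalizer S P \<inter> ?PQ"
  have D: "subgroup D S"
    unfolding D_def by (rule subgroups_Inter_pair[OF normalizer_subgroup[OF P] PQ])
  have "D = P"
  proof (rule radical_centric_extensions[OF P c essential_radical[OF E] D])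
    show PD: "P \<subseteq> D" using le le_normalizer[OF P] by (auto simp: D_def)
    show "D \<subseteq> normalizer S P" by (simp add: D_def)
    fix \<alpha> assume a: "\<alpha> \<in> F P P"
    obtain \<psi> where \<psi>: "\<psi> \<in> F ?PQ ?PQ" "restrict \<psi> P = \<alpha>"
      using fs_normalD(2)[OF Q a] by blast
    have \<psi>P: "\<psi> x = \<alpha> x" if "x \<in> P" for x using fun_cong[OF \<psi>(2), of x] that by simp
    have "\<psi> g \<in> D" if g: "g \<in> D" for g
    proof -
      have gPQ: "g \<in> ?PQ" and gN: "g \<in> normalizer S P" using g by (auto simp: D_def)
      have "\<psi> g \<otimes> y \<otimes> inv (\<psi> g) \<in> P" if y: "y \<in> P" for y
      proof -
        obtain x where x: "x \<in> P" "y = \<alpha> x" using y aut_image[OF a] by blast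
        have gx: "g \<otimes> x \<otimes> inv g \<in> P" using gN x P by (simp add: normalizer_finite_iff)
        have "\<psi> g \<otimes> y \<otimes> inv (\<psi> g) = \<psi> (g \<otimes> x \<otimes> inv g)"
          using hom_conj[OF \<psi>(1) gPQ, of x] x le \<psi>P by auto
        then show ?thesis using \<psi>P[OF gx] hom_closed[OF a gx] by simp
      qed
      then show ?thesis
        using hom_closed[OF \<psi>(1) gPQ] hom_carrier[OF \<psi>(1) gPQ] P by (simp add: D_def normalizer_finite_iff)
    qed
    then have "restrict \<psi> D \<in> F D D"
      by (intro hom_codomain[OF hom_restrict[OF \<psi>(1) D] D]) (auto simp: D_def)
    moreover have "\<forall>x \<in> P. restrict \<psi> D x = \<alpha> x" using \<psi>P PD by auto
    ultimately show "\<exists>\<psi> \<in> F D D. \<forall>x \<in> P. \<psi> x = \<alpha> x" by blast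
  qed
  then have "\<not> P \<subset> ?PQ"
    using normalizer_grows_within[OF prime_p PQ _ P] subgroup_p_card[OF PQ] by (metis D_def)
  then show ?thesis using le by blast
qed

end

context saturated_fusion_system
begin

lemma fully_normalised_S: "fully_normalised S F (carrier S)"
proof -
  have "normalizer S R \<subseteq> carrier S" for R by (auto simp: normalizer_def stabilizer_def)
  then show ?thesis using card_mono[OF finite_S] by (simp add: fully_normalised_def normalizer_S)
qed

text \<open>For \<open>S\<close> itself the Sylow axiom says that $\mathrm{Inn}(S)$ is a Sylow subgroup of
  $\mathrm{Aut}_{\mathcal{F}}(S)$.\<close>

lemma out_S_not_dvd: "\<not> p dvd order (out_group S F (carrier S))"
proof -
  interpret A: group "aut_group F (carrier S)" by (rule aut_group_is_group[OF subgroup_self])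
  have "sylow_subgroup p (aut_group F (carrier S)) (conj_homs S (carrier S) (carrier S) (carrier S))"
    using fully_normalised_sylow[OF subgroup_self fully_normalised_S] by blast
  then show ?thesis
    using A.sylow_index_not_dvd[OF _ prime_p] finite_aut by (simp add: out_group_def FactGroup_def order_def)
qed

lemma S_not_essential: "carrier S \<notin> essential_subgroups p S F"
proof
  assume "carrier S \<in> essential_subgroups p S F"
  then obtain H where H: "strongly_p_embedded p (out_group S F (carrier S)) H"
    by (auto simp: essential_subgroups_def)
  interpret out: group "out_group S F (carrier S)" by (rule out_group_is_group[OF subgroup_self])
  have "card H dvd order (out_group S F (carrier S))"
    using H out.lagrange by (metis strongly_p_embedded_def dvd_triv_right)
  then show False using H out_S_not_dvd by (meson strongly_p_embedded_def dvd_trans)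
qed

lemma S_fcr: "carrier S \<in> fcr_subgroups p S F"
proof -
  have "fs_centric S F (carrier S)"
    unfolding fs_centric_def fs_isomorphic_iff using aut_image by (auto simp: centre_def)
  moreover have "fs_radical p S F (carrier S)"
    unfolding fs_radical_def
  proof (rule p_core_trivialI)
    interpret out: group "out_group S F (carrier S)" by (rule out_group_is_group[OF subgroup_self])
    show "group (out_group S F (carrier S))" by (rule out.is_group)
    fix N n assume N: "N \<lhd> out_group S F (carrier S)" and n: "card N = p ^ n"
    have Ns: "subgroup N (out_group S F (carrier S))" by (rule normal_imp_subgroup[OF N])
    have "p ^ n dvd order (out_group S F (carrier S))"
      using out.lagrange[OF Ns] n by (metis dvd_triv_right)
    then have "n = 0" using out_S_not_dvd by (metis dvd_power dvd_trans neq0_conv)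
    then obtain y where "N = {y}" using n card_1_singletonE by auto
    then show "N = {\<one>\<^bsub>out_group S F (carrier S)\<^esub>}" using subgroup.one_closed[OF Ns] by simp
  qed
  ultimately show ?thesis using fully_normalised_S subgroup_self by (simp add: fcr_subgroups_def)
qed

end

section \<open>Normaliser systems and local rank\<close>

context fusion_system
begin

lemma subgroup_normaliser_group_iff:
  assumes Q: "subgroup Q S"
  shows "subgroup U (normaliser_group S Q) \<longleftrightarrow> subgroup U S \<and> U \<subseteq> normalizer S Q"
  using incl_subgroup[OF normalizer_subgroup[OF Q]] subgroup_incl[OF _ normalizer_subgroup[OF Q]]
    subgroup.subset by (fastforce simp: normaliser_group_def)

lemma normaliser_systemI:
  assumes Q: "subgroup Q S" and h: "\<phi> \<in> F U V" and le: "U \<subseteq> normalizer S Q" "V \<subseteq> normalizer S Q"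
    and e: "\<psi> \<in> F (U <#> Q) (V <#> Q)" "\<psi> ` Q = Q" "\<And>x. x \<in> U \<Longrightarrow> \<psi> x = \<phi> x"
  shows "\<phi> \<in> normaliser_system S F Q U V"
proof -
  have "restrict \<psi> U = \<phi>"
    using hom_ext[OF h] e(3) by (intro extensionalityI[of _ U]) simp_all
  then show ?thesis
    unfolding normaliser_system_def subgroup_normaliser_group_iff[OF Q]
    using h le e hom_source[OF h] hom_target[OF h] by blast
qed

lemma normaliser_systemE:
  assumes Q: "subgroup Q S" and h: "\<phi> \<in> normaliser_system S F Q U V"
  obtains \<psi> where "\<phi> \<in> F U V" "subgroup U S" "subgroup V S" "U \<subseteq> normalizer S Q" "V \<subseteq> normalizer S Q"
    "\<psi> \<in> F (U <#> Q) (V <#> Q)" "\<psi> ` Q = Q" "\<And>x. x \<in> U \<Longrightarrow> \<psi> x = \<phi> x"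
proof -
  obtain \<psi> where \<psi>: "\<psi> \<in> F (U <#> Q) (V <#> Q)" "\<psi> ` Q = Q" "restrict \<psi> U = \<phi>"
    using h by (auto simp: normaliser_system_def)
  have "\<psi> x = \<phi> x" if "x \<in> U" for x using fun_cong[OF \<psi>(3), of x] that by simp
  then show ?thesis
    using that[of \<psi>] \<psi> h unfolding normaliser_system_def subgroup_normaliser_group_iff[OF Q] by blast
qed

lemma mult_normaliser:
  assumes Q: "subgroup Q S" and U: "subgroup U S" "U \<subseteq> normalizer S Q"
  shows "subgroup (U <#> Q) S" "U <#> Q \<subseteq> normalizer S Q" "U \<subseteq> U <#> Q" "Q \<subseteq> U <#> Q"
proof -
  let ?N = "normaliser_group S Q"
  interpret N: group ?N
    unfolding normaliser_group_def by (rule subgroup_imp_group[OF normalizer_subgroup[OF Q]])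
  have norm: "Q \<lhd> ?N" unfolding normaliser_group_def by (rule subgroup_in_normalizer[OF Q])
  have UN: "subgroup U ?N" using U subgroup_normaliser_group_iff[OF Q] by blast
  have "subgroup (Q <#>\<^bsub>?N\<^esub> U) ?N" by (rule N.mult_norm_subgroup[OF norm UN])
  moreover have "Q <#>\<^bsub>?N\<^esub> U = U <#>\<^bsub>?N\<^esub> Q" using N.commut_normal[OF UN norm] by simp
  moreover have "U <#>\<^bsub>?N\<^esub> Q = U <#> Q" by (simp add: normaliser_group_def set_mult_def)
  ultimately show "subgroup (U <#> Q) S" "U <#> Q \<subseteq> normalizer S Q"
    using subgroup_normaliser_group_iff[OF Q] by auto
  show "U \<subseteq> U <#> Q" "Q \<subseteq> U <#> Q"
    using subgroup.one_closed[OF Q] subgroup.one_closed[OF U(1)] subgroup.mem_carrier[OF Q]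
      subgroup.mem_carrier[OF U(1)] r_one l_one unfolding set_mult_def by (force, force)
qed

lemma normaliser_conj_map:
  assumes Q: "subgroup Q S" and g: "g \<in> normalizer S Q"
  shows "conj_map (normaliser_group S Q) U g = conj_map S U g"
  using m_inv_consistent[OF normalizer_subgroup[OF Q] g] by (simp add: conj_map_def normaliser_group_def)

text \<open>The local rank is \<open>0\<close> by default outside fusion systems. So only because normaliser systems are fusion
  systems does rank \<open>0\<close> carry information about their cores.\<close>

lemma normaliser_system_fusion_system:
  assumes Q: "subgroup Q S"
  shows "fusion_system p (normaliser_group S Q) (normaliser_system S F Q)"
proof -
  let ?N = "normalizer S Q" and ?G = "normaliser_group S Q" and ?F = "normaliser_system S F Q"
  note Ns = normalizer_subgroup[OF Q] and sub_iff = subgroup_normaliser_group_iff[OF Q]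
  have upd: "?G\<lparr>carrier := U\<rparr> = S\<lparr>carrier := U\<rparr>" for U by (simp add: normaliser_group_def)
  interpret G: group ?G
    unfolding normaliser_group_def by (rule subgroup_imp_group[OF Ns])
  show ?thesis
  proof unfold_locales
    show "Factorial_Ring.prime p" by (rule prime_p)
    show "\<exists>n. order ?G = p ^ n" using subgroup_p_card[OF Ns] by (simp add: order_def normaliser_group_def)
  next
    fix \<phi> U V assume "\<phi> \<in> ?F U V"
    then show "subgroup U ?G \<and> subgroup V ?G" by (simp add: normaliser_system_def)
  next
    fix U V assume "subgroup U ?G" "subgroup V ?G"
    then have U: "subgroup U S" "U \<subseteq> ?N" and V: "subgroup V S" "V \<subseteq> ?N" using sub_iff by auto
    note UQ = mult_normaliser[OF Q U] and VQ = mult_normaliser[OF Q V]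
    show "conj_homs ?G (carrier ?G) U V \<subseteq> ?F U V"
    proof
      fix \<gamma> assume "\<gamma> \<in> conj_homs ?G (carrier ?G) U V"
      then obtain g where "g \<in> carrier ?G" "\<gamma> = conj_map ?G U g" "conj_map ?G U g ` U \<subseteq> V"
        unfolding conj_homs_def by blast
      then have g: "g \<in> ?N" "\<gamma> = conj_map S U g" "conj_map S U g ` U \<subseteq> V"
        using normaliser_conj_map[OF Q] by (simp_all add: normaliser_group_def)
      have gc: "g \<in> carrier S" and gQ: "\<And>x. x \<in> Q \<Longrightarrow> g \<otimes> x \<otimes> inv g \<in> Q"
        using g Q by (auto simp: normalizer_finite_iff)
      have gU: "g \<otimes> x \<otimes> inv g \<in> V" if "x \<in> U" for x using g(3) that by (auto simp: conj_map_def)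
      have "g \<otimes> x \<otimes> inv g \<in> V <#> Q" if x: "x \<in> U <#> Q" for x
      proof -
        obtain u q where uq: "u \<in> U" "q \<in> Q" "x = u \<otimes> q" using x by (auto simp: set_mult_def)
        then have "g \<otimes> x \<otimes> inv g = (g \<otimes> u \<otimes> inv g) \<otimes> (g \<otimes> q \<otimes> inv g)"
          using conj_mult gc subgroup.mem_carrier[OF U(1)] subgroup.mem_carrier[OF Q] by simp
        then show ?thesis using gU[OF uq(1)] gQ[OF uq(2)] unfolding set_mult_def by blast
      qed
      then have \<psi>: "conj_map S (U <#> Q) g \<in> F (U <#> Q) (V <#> Q)"
        by (rule conj_hom[OF UQ(1) VQ(1) gc])
      have "conj_map S (U <#> Q) g ` Q = Q"
      proof (rule endo_inj_surj[OF finite_subgroup[OF Q]])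
        show "conj_map S (U <#> Q) g ` Q \<subseteq> Q" using gQ UQ(4) by (auto simp: conj_map_def)
        show "inj_on (conj_map S (U <#> Q) g) Q" using inj_on_subset[OF hom_inj[OF \<psi>] UQ(4)] .
      qed
      moreover have "\<gamma> \<in> F U V" unfolding g(2) using gU by (intro conj_hom[OF U(1) V(1) gc])
      moreover have "conj_map S (U <#> Q) g x = \<gamma> x" if "x \<in> U" for x
        using that UQ(3) by (auto simp: g(2) conj_map_def)
      ultimately show "\<gamma> \<in> ?F U V" using normaliser_systemI[OF Q _ U(2) V(2) \<psi>] by blast
    qed
  next
    fix U V
    have "?F U V \<subseteq> F U V" by (rule normaliser_system_le)
    then show "?F U V \<subseteq> mon (?G\<lparr>carrier := U\<rparr>) (?G\<lparr>carrier := V\<rparr>) \<inter> extensional U"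
      unfolding upd using inj_hom by blast
  next
    fix \<phi> \<psi> U V W assume h: "\<phi> \<in> ?F U V" "\<psi> \<in> ?F V W"
    obtain \<phi>' where 1: "\<phi> \<in> F U V" "subgroup U S" "subgroup V S" "U \<subseteq> ?N" "V \<subseteq> ?N"
      "\<phi>' \<in> F (U <#> Q) (V <#> Q)" "\<phi>' ` Q = Q" "\<And>x. x \<in> U \<Longrightarrow> \<phi>' x = \<phi> x"
      using normaliser_systemE[OF Q h(1)] by metis
    obtain \<psi>' where 2: "\<psi> \<in> F V W" "subgroup V S" "subgroup W S" "V \<subseteq> ?N" "W \<subseteq> ?N"
      "\<psi>' \<in> F (V <#> Q) (W <#> Q)" "\<psi>' ` Q = Q" "\<And>x. x \<in> V \<Longrightarrow> \<psi>' x = \<psi> x"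
      using normaliser_systemE[OF Q h(2)] by metis
    note UQ = mult_normaliser[OF Q 1(2,4)]
    show "compose U \<psi> \<phi> \<in> ?F U W"
    proof (rule normaliser_systemI[OF Q comp[OF 1(1) 2(1)] 1(4) 2(5) comp[OF 1(6) 2(6)]])
      have "compose (U <#> Q) \<psi>' \<phi>' ` Q = \<psi>' ` \<phi>' ` Q" using UQ(4) by (force simp: compose_def)
      then show "compose (U <#> Q) \<psi>' \<phi>' ` Q = Q" using 1(7) 2(7) by simp
      show "compose (U <#> Q) \<psi>' \<phi>' x = compose U \<psi> \<phi> x" if "x \<in> U" for x
        using that UQ(3) 1(8) 2(8) hom_closed[OF 1(1)] by (auto simp: compose_def)
    qed
  next
    fix \<phi> U V assume h: "\<phi> \<in> ?F U V"
    obtain \<psi> where 1: "\<phi> \<in> F U V" "subgroup U S" "subgroup V S" "U \<subseteq> ?N" "V \<subseteq> ?N"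
      "\<psi> \<in> F (U <#> Q) (V <#> Q)" "\<psi> ` Q = Q" "\<And>x. x \<in> U \<Longrightarrow> \<psi> x = \<phi> x"
      using normaliser_systemE[OF Q h] by metis
    let ?W = "\<phi> ` U" and ?i = "restrict (inv_into (U <#> Q) \<psi>) (\<psi> ` (U <#> Q))"
    note UQ = mult_normaliser[OF Q 1(2,4)]
    have W: "subgroup ?W S" "?W \<subseteq> ?N" using hom_image_subgroup[OF 1(1)] hom_img[OF 1(1)] 1(5) by auto
    have inj: "inj_on \<psi> (U <#> Q)" by (rule hom_inj[OF 1(6)])
    have im: "\<psi> ` (U <#> Q) = ?W <#> Q"
    proof -
      have "\<psi> (u \<otimes> q) = \<phi> u \<otimes> \<psi> q" if "u \<in> U" "q \<in> Q" for u q
        using hom_mult[OF 1(6)] UQ(3,4) that 1(8) by (metis subsetD)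
      then have "\<psi> ` (U <#> Q) = ?W <#> \<psi> ` Q"
        unfolding set_mult_def by (auto simp: image_UN)
      then show ?thesis using 1(7) by simp
    qed
    have retract: "?i (\<psi> x) = x" if "x \<in> U <#> Q" for x using that inj by simp
    have "\<phi> \<in> ?F U ?W"
      using normaliser_systemI[OF Q hom_onto_image[OF 1(1)] 1(4) W(2) _ 1(7,8)]
        hom_onto_image[OF 1(6)] im by simp
    moreover have "restrict (inv_into U \<phi>) ?W \<in> ?F ?W U"
    proof (rule normaliser_systemI[OF Q hom_inverse[OF 1(1)] W(2) 1(4)])
      show "?i \<in> F (?W <#> Q) (U <#> Q)" using hom_inverse[OF 1(6)] im by simp
      have "?i ` \<psi> ` Q = (\<lambda>x. x) ` Q"
        unfolding image_image using UQ(4) by (intro image_cong refl retract) (rule subsetD)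
      then show "?i ` Q = Q" using 1(7) by simp
      fix y assume "y \<in> ?W"
      then obtain x where x: "x \<in> U" "y = \<phi> x" by blast
      then have "?i y = x" using retract[of x] UQ(3) 1(8)[OF x(1)] by auto
      then show "?i y = restrict (inv_into U \<phi>) ?W y"
        using x inv_into_f_f[OF hom_inj[OF 1(1)] x(1)] by simp
    qed
    moreover have "bij_betw \<phi> U ?W" using hom_inj[OF 1(1)] by (simp add: bij_betw_def)
    ultimately show "\<phi> \<in> fs_isos ?F U ?W" by (simp add: fs_isos_def)
  qed
qed

end

context saturated_fusion_system
begin

lemma S_mult: "subgroup U S \<Longrightarrow> U <#> carrier S = carrier S"
  using mult_normaliser[OF subgroup_self, of U] subgroup.subset[of U] by (auto simp: normalizer_S)

lemma local_rank_eq_0_iff: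
  assumes Q: "subgroup Q S"
  shows "local_rank p (normaliser_group S Q) (normaliser_system S F Q) = 0 \<longleftrightarrow>
    fs_core (normaliser_group S Q) (normaliser_system S F Q) = normalizer S Q"
  using normaliser_system_fusion_system[OF Q] by (subst local_rank.simps) (simp add: normaliser_group_def)

text \<open>If the core is proper, the maximum is over a non-empty set, as \<open>S\<close> itself is fully normalised, centric
  and radical; so it is \<open>0\<close> exactly when all of its entries are.\<close>

lemma local_rank_eq_1_iff:
  "local_rank p S F = 1 \<longleftrightarrow> fs_core S F \<noteq> carrier S \<and>
    (\<forall>R \<in> fcr_subgroups p S F. fs_core S F \<subset> R \<longrightarrow>
       fs_core (normaliser_group S R) (normaliser_system S F R) = normalizer S R)"
proof (cases "fs_core S F = carrier S")
  case True
  then show ?thesis by (subst local_rank.simps) simp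
next
  case False
  let ?r = "\<lambda>R. local_rank p (normaliser_group S R) (normaliser_system S F R)"
  let ?M = "{R \<in> fcr_subgroups p S F. fs_core S F \<subset> R}"
  have "?M \<subseteq> Pow (carrier S)" by (auto simp: fcr_subgroups_def dest: subgroup.subset)
  then have fin: "finite ?M" using finite_S by (simp add: finite_subset)
  have "fs_core S F \<subset> carrier S"
    using False fs_core_normal by (auto simp: fs_normal_def dest: subgroup.subset)
  then have "?M \<noteq> {}" using S_fcr by blast
  define A where "A = ?r ` ?M"
  have A: "finite A" "A \<noteq> {}" using fin \<open>?M \<noteq> {}\<close> unfolding A_def by blast+
  have "Max A = 0 \<longleftrightarrow> (\<forall>k \<in> A. k = 0)"
    using Max_in[OF A] Max_ge[OF A(1)] by (metis le_zero_eq)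
  moreover have "local_rank p S F = 1 + Max A"
    unfolding A_def using False fusion_system_axioms by (subst local_rank.simps) simp
  ultimately have "local_rank p S F = 1 \<longleftrightarrow> (\<forall>R \<in> ?M. ?r R = 0)"
    by (simp add: A_def)
  then show ?thesis
    using False local_rank_eq_0_iff by (auto simp: fcr_subgroups_def)
qed

lemma not_all_extend:
  assumes "fs_core S F \<noteq> carrier S"
  shows "\<exists>P \<phi>. \<phi> \<in> F P (carrier S) \<and> \<not> extends_to_S P \<phi>"
proof (rule ccontr)
  assume all: "\<not> ?thesis"
  have "fs_normal S F (carrier S)"
  proof (rule fs_normalI)
    show "carrier S \<lhd> S" using normal_inv_iff subgroup_self by auto
    fix U V \<phi> assume h: "\<phi> \<in> F U V"
    have "extends_to_S U \<phi>" using all hom_into_S[OF h] by blast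
    then obtain \<psi> where \<psi>: "\<psi> \<in> F (carrier S) (carrier S)" "\<forall>x \<in> U. \<psi> x = \<phi> x"
      by (auto simp: extends_to_S_def)
    have "restrict \<psi> U = \<phi>" using \<psi> hom_ext[OF h] by (intro extensionalityI[of _ U]) simp_all
    then show "\<exists>\<psi> \<in> F (U <#> carrier S) (V <#> carrier S). \<psi> ` carrier S = carrier S \<and> restrict \<psi> U = \<phi>"
      using \<psi>(1) aut_image[OF \<psi>(1)] S_mult hom_source[OF h] hom_target[OF h] by auto
  qed
  then show False
    using fs_core_upper assms fs_core_normal by (auto simp: fs_normal_def dest: subgroup.subset)
qed

lemma fs_core_normaliser_S:
  "fs_core (normaliser_group S (carrier S)) (normaliser_system S F (carrier S)) = carrier S"
proof -
  let ?F = "normaliser_system S F (carrier S)"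
  have G: "normaliser_group S (carrier S) = S" by (simp add: normaliser_group_def normalizer_S)
  interpret NS: fusion_system p S ?F
    using normaliser_system_fusion_system[OF subgroup_self] G by simp
  have "fs_normal S ?F (carrier S)"
  proof (rule NS.fs_normalI)
    show "carrier S \<lhd> S" using normal_inv_iff subgroup_self by auto
    fix U V \<phi> assume h: "\<phi> \<in> ?F U V"
    obtain \<psi> where \<psi>: "\<phi> \<in> F U V" "\<psi> \<in> F (carrier S) (carrier S)" "\<psi> ` carrier S = carrier S" "restrict \<psi> U = \<phi>"
      using h S_mult by (auto simp: normaliser_system_def G)
    have "\<psi> \<in> ?F (carrier S) (carrier S)"
      using \<psi>(2,3) S_mult[OF subgroup_self] normalizer_S
      by (intro normaliser_systemI[of _ _ _ _ \<psi>] subgroup_self) simp_all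
    then show "\<exists>\<psi> \<in> ?F (U <#> carrier S) (V <#> carrier S). \<psi> ` carrier S = carrier S \<and> restrict \<psi> U = \<phi>"
      using \<psi> S_mult hom_source[OF \<psi>(1)] hom_target[OF \<psi>(1)] by auto
  qed
  then show ?thesis
    using NS.fs_core_upper NS.fs_core_normal G by (auto simp: fs_normal_def dest: subgroup.subset)
qed

text \<open>An automorphism of \<open>Q\<close> belongs to the normaliser system of \<open>Q\<close>, in which the normaliser of \<open>Q\<close> is now a
  normal subgroup.\<close>

lemma normaliser_core_extends:
  assumes Q: "subgroup Q S" and core: "fs_core (normaliser_group S Q) (normaliser_system S F Q) = normalizer S Q"
    and a: "\<alpha> \<in> F Q Q"
  shows "\<exists>\<psi> \<in> F (normalizer S Q) (normalizer S Q). \<forall>x \<in> Q. \<psi> x = \<alpha> x"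
proof -
  let ?N = "normalizer S Q" and ?G = "normaliser_group S Q" and ?F = "normaliser_system S F Q"
  interpret N: fusion_system p ?G ?F by (rule normaliser_system_fusion_system[OF Q])
  have QN: "Q \<subseteq> ?N" by (rule le_normalizer[OF Q])
  have QQ: "Q <#> Q = Q" using Q by (rule subgroup_mult_id)
  have "\<alpha> \<in> ?F Q Q" using a aut_image[OF a] QQ QN by (intro normaliser_systemI[OF Q a]) simp_all
  moreover have "fs_normal ?G ?F ?N" using N.fs_core_normal core by simp
  ultimately obtain \<psi> where \<psi>: "\<psi> \<in> ?F (Q <#>\<^bsub>?G\<^esub> ?N) (Q <#>\<^bsub>?G\<^esub> ?N)" "restrict \<psi> Q = \<alpha>"
    using N.fs_normalD(2) by blast
  have "Q <#>\<^bsub>?G\<^esub> ?N = ?N"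
  proof
    show "Q <#>\<^bsub>?G\<^esub> ?N \<subseteq> ?N"
      using QN subgroup.m_closed[OF normalizer_subgroup[OF Q]] by (auto simp: set_mult_def normaliser_group_def)
    show "?N \<subseteq> Q <#>\<^bsub>?G\<^esub> ?N"
      using subgroup.one_closed[OF Q] subgroup.mem_carrier[OF normalizer_subgroup[OF Q]] l_one
      unfolding set_mult_def normaliser_group_def by force
  qed
  then have "\<psi> \<in> F ?N ?N" using \<psi>(1) normaliser_system_le[of Q ?N ?N] by auto
  moreover have "\<psi> x = \<alpha> x" if "x \<in> Q" for x using fun_cong[OF \<psi>(2), of x] that by simp
  ultimately show ?thesis by blast
qed

text \<open>Essential subgroups contain the core. If one is larger than the core, all of its automorphisms extend
  to its normaliser, so it equals \<open>S\<close>, which is not essential. And there is one, since otherwise every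
  morphism would extend to \<open>S\<close> and the core would be \<open>S\<close>.\<close>

lemma essential_eq_core_if_normaliser_cores:
  assumes ne: "fs_core S F \<noteq> carrier S"
    and cores: "\<And>R. R \<in> fcr_subgroups p S F \<Longrightarrow> fs_core S F \<subset> R \<Longrightarrow>
       fs_core (normaliser_group S R) (normaliser_system S F R) = normalizer S R"
  shows "essential_subgroups p S F = {fs_core S F}"
proof -
  have "P = fs_core S F" if P: "P \<in> essential_subgroups p S F" for P
  proof (rule ccontr)
    assume "P \<noteq> fs_core S F"
    then have less: "fs_core S F \<subset> P" using essential_contains_normal[OF P fs_core_normal] by blast
    have fcr: "P \<in> fcr_subgroups p S F" using P essential_fcr by blast
    have Ps: "subgroup P S" and c: "fs_centric S F P" and r: "fs_radical p S F P"
      using fcr by (auto simp: fcr_subgroups_def)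
    have "normalizer S P = P"
      using normaliser_core_extends[OF Ps cores[OF fcr less]]
      by (intro radical_centric_extensions[OF Ps c r normalizer_subgroup[OF Ps] le_normalizer[OF Ps] subset_refl])
    then have "P = carrier S" by (rule normalizer_eq_self[OF Ps])
    then show False using P S_not_essential by simp
  qed
  moreover have "essential_subgroups p S F \<noteq> {}"
  proof
    assume "essential_subgroups p S F = {}"
    then have "extends_to_S P \<phi>" if "\<phi> \<in> F P (carrier S)" for P \<phi>
      using extends_if_no_essential[of UNIV P \<phi>] that by simp
    then show False using not_all_extend[OF ne] by blast
  qed
  ultimately show ?thesis by blast
qed

text \<open>The subgroups properly containing the core form a family as in Alperin's theorem: none is essential,
  and conjugates again contain the core, because morphisms defined on the core map it onto itself. So all
  automorphisms of \<open>R\<close> extend to \<open>S\<close> and, by restriction, to the normaliser of \<open>R\<close>.\<close>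

lemma fcr_above_only_essential_core:
  assumes ess: "essential_subgroups p S F = {fs_core S F}"
    and R: "R \<in> fcr_subgroups p S F" "fs_core S F \<subset> R"
  shows "R = carrier S"
proof -
  let ?Q = "fs_core S F"
  have Rs: "subgroup R S" and c: "fs_centric S F R" and r: "fs_radical p S F R"
    using R by (auto simp: fcr_subgroups_def)
  note Q = fs_core_normal
  have Qs: "subgroup ?Q S" using Q by (simp add: fs_normal_def)
  have ext: "extends_to_S R \<phi>" if "\<phi> \<in> F R (carrier S)" for \<phi>
  proof (rule extends_if_no_essential[of "{P. subgroup P S \<and> ?Q \<subset> P}"])
    show "{P. subgroup P S \<and> ?Q \<subset> P} \<inter> essential_subgroups p S F = {}" using ess by auto
    fix P \<phi> assume "P \<in> {P. subgroup P S \<and> ?Q \<subset> P}" and h: "\<phi> \<in> F P (carrier S)"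
    then have P: "subgroup P S" "?Q \<subset> P" by auto
    obtain \<psi> where \<psi>: "\<psi> ` ?Q = ?Q" "restrict \<psi> P = \<phi>" using fs_normalD(2)[OF Q h] by blast
    have "\<phi> x = \<psi> x" if "x \<in> P" for x using fun_cong[OF \<psi>(2), of x] that by simp
    then have Qim: "\<phi> ` ?Q = ?Q" using \<psi>(1) P(2) by (metis image_cong psubsetD)
    obtain x where x: "x \<in> P" "x \<notin> ?Q" using P(2) by blast
    have "\<phi> x \<notin> \<phi> ` ?Q" using x P(2) inj_on_image_mem_iff[OF hom_inj[OF h] x(1)] by blast
    then have "?Q \<subset> \<phi> ` P" using Qim P(2) x by blast
    then show "\<phi> ` P \<in> {P. subgroup P S \<and> ?Q \<subset> P}" using hom_image_subgroup[OF h] by blast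
  qed (use Rs R that in auto)
  let ?N = "normalizer S R"
  have Ns: "subgroup ?N S" by (rule normalizer_subgroup[OF Rs])
  have "?N = R"
  proof (rule radical_centric_extensions[OF Rs c r Ns le_normalizer[OF Rs] subset_refl])
    fix \<alpha> assume a: "\<alpha> \<in> F R R"
    obtain \<psi> where \<psi>: "\<psi> \<in> F (carrier S) (carrier S)" "\<forall>x \<in> R. \<psi> x = \<alpha> x"
      using ext[OF hom_into_S[OF a]] by (auto simp: extends_to_S_def)
    have "\<psi> g \<in> ?N" if g: "g \<in> ?N" for g
    proof -
      have gc: "g \<in> carrier S" using subgroup.mem_carrier[OF Ns g] .
      have "\<psi> g \<otimes> y \<otimes> inv (\<psi> g) \<in> R" if y: "y \<in> R" for y
      proof -
        obtain x where x: "x \<in> R" "y = \<alpha> x" using y aut_image[OF a] by blast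
        have gx: "g \<otimes> x \<otimes> inv g \<in> R" using g x Rs by (simp add: normalizer_finite_iff)
        have "\<psi> g \<otimes> y \<otimes> inv (\<psi> g) = \<psi> (g \<otimes> x \<otimes> inv g)"
          using hom_conj[OF \<psi>(1) gc subgroup.mem_carrier[OF Rs x(1)]] x \<psi>(2) by auto
        then show ?thesis using \<psi>(2) gx hom_closed[OF a gx] by simp
      qed
      then show ?thesis using hom_carrier[OF \<psi>(1) gc] by (simp add: normalizer_finite_iff[OF Rs])
    qed
    then have "restrict \<psi> ?N \<in> F ?N ?N"
      by (intro hom_codomain[OF hom_restrict[OF \<psi>(1) Ns subgroup.subset[OF Ns]] Ns]) auto
    moreover have "\<forall>x \<in> R. restrict \<psi> ?N x = \<alpha> x" using \<psi>(2) le_normalizer[OF Rs] by auto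
    ultimately show "\<exists>\<psi> \<in> F ?N ?N. \<forall>x \<in> R. \<psi> x = \<alpha> x" by blast
  qed
  then show ?thesis by (rule normalizer_eq_self[OF Rs])
qed

end

theorem proposition5p3:
  fixes p :: nat and S :: "('a, 'b) monoid_scheme" and F :: "'a hom_system"
  assumes "saturated_fusion_system p S F"
  shows "local_rank p S F = 1 \<longleftrightarrow> essential_subgroups p S F = {fs_core S F}"
proof -
  interpret saturated_fusion_system p S F by (rule assms)
  show ?thesis
  proof
    assume "local_rank p S F = 1"
    then show "essential_subgroups p S F = {fs_core S F}"
      unfolding local_rank_eq_1_iff by (intro essential_eq_core_if_normaliser_cores) auto
  next
    assume ess: "essential_subgroups p S F = {fs_core S F}"
    have "fs_core S F \<noteq> carrier S" using ess S_not_essential by auto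
    moreover have "fs_core (normaliser_group S R) (normaliser_system S F R) = normalizer S R"
      if "R \<in> fcr_subgroups p S F" "fs_core S F \<subset> R" for R
    proof -
      have "R = carrier S" by (rule fcr_above_only_essential_core[OF ess that])
      then show ?thesis using fs_core_normaliser_S normalizer_S by simp
    qed
    ultimately show "local_rank p S F = 1" unfolding local_rank_eq_1_iff by blast
  qed
qed

end
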